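(* Every infinite $\Pi^0_2$ equivalence relation $E$ on $\omega$ satisfies $\mathrm{Id}\le E^{\dotplus}$, but there are infinite $\Sigma^0_2$ equivalence relations $E$ on $\omega$ such that $\mathrm{Id}\not\le E^{\dotplus}$.
   Context: $W_e$ denotes the $e$th c.e. set. For equivalence relations $E,R$ on $\omega$, $E\le R$ means there is a total computable $f$ with $x\mathrel{E}y\Leftrightarrow f(x)\mathrel{R}f(y)$ for all $x,y$. $[S]_E$ is the $E$-closure of $S\subseteq\omega$. The jump $E^{\dotplus}$ is defined by $x\mathrel{E^{\dotplus}}y\Leftrightarrow [W_x]_E=[W_y]_E$. $\mathrm{Id}$ is the identity relation on $\omega$. An equivalence relation is infinite if it has infinitely many equivalence classes. An equivalence relation is $\Pi^0_2$ (respectively $\Sigma^0_2$) if it is so as a set of pairs. *)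

theory Defs
  imports Main "HOL-Library.Nat_Bijection"
begin

text \<open>
  Programs for unary partial recursive functions. Functions of several arguments are
  represented through the Cantor pairing bijection \<^const>\<open>prod_encode\<close>, which is why the
  projections and the pairing of two functions occur among the basic operations.
\<close>

datatype prog =
    PZero
  | PSucc
  | PFst
  | PSnd
  | PPair prog prog
  | PComp prog prog
  | PRec prog prog
  | PMu prog

text \<open>
  \<^term>\<open>run p x = None\<close> means that \<open>p\<close> diverges on input \<open>x\<close>. As usual, the unbounded search
  \<open>PMu f\<close> returns \<open>n\<close> only if \<open>f\<close> converges to nonzero values at all \<open>m < n\<close>.
\<close>

primrec run :: "prog \<Rightarrow> nat \<Rightarrow> nat option" where
  "run PZero x = Some 0"
| "run PSucc x = Some (Suc x)"
| "run PFst x = Some (fst (prod_decode x))"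
| "run PSnd x = Some (snd (prod_decode x))"
| "run (PPair f g) x =
     Option.bind (run f x) (\<lambda>a. Option.bind (run g x) (\<lambda>b. Some (prod_encode (a, b))))"
| "run (PComp f g) x = Option.bind (run g x) (run f)"
| "run (PRec f g) x =
     (let (a, n) = prod_decode x
      in rec_nat (run f a)
           (\<lambda>m r. Option.bind r (\<lambda>v. run g (prod_encode (a, prod_encode (m, v))))) n)"
| "run (PMu f) x =
     (let P = (\<lambda>n. run f (prod_encode (x, n)) = Some 0 \<and>
                   (\<forall>m<n. \<exists>v>0. run f (prod_encode (x, m)) = Some v))
      in if \<exists>n. P n then Some (LEAST n. P n) else None)"

definition total_computable :: "(nat \<Rightarrow> nat) \<Rightarrow> bool" where
  "total_computable f \<longleftrightarrow> (\<exists>p. \<forall>x. run p x = Some (f x))"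

lemma fst_prod_decode_le: "fst (prod_decode n) \<le> n"
  by (metis le_prod_encode_1 prod.collapse prod_decode_inverse)

lemma snd_prod_decode_le: "snd (prod_decode n) \<le> n"
  by (metis le_prod_encode_2 prod.collapse prod_decode_inverse)

text \<open>A Goedel numbering of programs. It is effective in both directions and bijective, with
  inverse \<open>nat_of_prog\<close> below, so it induces an acceptable numbering of the
  partial recursive functions.\<close>

function (sequential) prog_of_nat :: "nat \<Rightarrow> prog" where
  "prog_of_nat 0 = PZero"
| "prog_of_nat (Suc 0) = PSucc"
| "prog_of_nat (Suc (Suc 0)) = PFst"
| "prog_of_nat (Suc (Suc (Suc 0))) = PSnd"
| "prog_of_nat (Suc (Suc (Suc (Suc n)))) =
     (let m = n div 4; a = fst (prod_decode m); b = snd (prod_decode m) in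
      if n mod 4 = 0 then PPair (prog_of_nat a) (prog_of_nat b)
      else if n mod 4 = 1 then PComp (prog_of_nat a) (prog_of_nat b)
      else if n mod 4 = 2 then PRec (prog_of_nat a) (prog_of_nat b)
      else PMu (prog_of_nat m))"
  by pat_completeness auto

lemma fst_prod_decode_less: "fst (prod_decode (n div k)) < Suc (Suc (Suc (Suc n)))"
  using fst_prod_decode_le[of "n div k"] div_le_dividend[of n k] by linarith

lemma snd_prod_decode_less: "snd (prod_decode (n div k)) < Suc (Suc (Suc (Suc n)))"
  using snd_prod_decode_le[of "n div k"] div_le_dividend[of n k] by linarith

lemma div_less_Suc4: "n div k < Suc (Suc (Suc (Suc n)))"
  using div_le_dividend[of n k] by linarith

termination
  by (relation "measure id")
    (simp_all only: wf_measure in_measure id_apply fst_prod_decode_less snd_prod_decode_less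
      div_less_Suc4)

fun nat_of_prog :: "prog \<Rightarrow> nat" where
  "nat_of_prog PZero = 0"
| "nat_of_prog PSucc = 1"
| "nat_of_prog PFst = 2"
| "nat_of_prog PSnd = 3"
| "nat_of_prog (PPair f g) = 4 * prod_encode (nat_of_prog f, nat_of_prog g) + 4"
| "nat_of_prog (PComp f g) = 4 * prod_encode (nat_of_prog f, nat_of_prog g) + 5"
| "nat_of_prog (PRec f g) = 4 * prod_encode (nat_of_prog f, nat_of_prog g) + 6"
| "nat_of_prog (PMu f) = 4 * nat_of_prog f + 7"

lemma prog_of_nat_add4:
  "prog_of_nat (n + 4) =
     (let m = n div 4; a = fst (prod_decode m); b = snd (prod_decode m) in
      if n mod 4 = 0 then PPair (prog_of_nat a) (prog_of_nat b)
      else if n mod 4 = 1 then PComp (prog_of_nat a) (prog_of_nat b)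
      else if n mod 4 = 2 then PRec (prog_of_nat a) (prog_of_nat b)
      else PMu (prog_of_nat m))"
proof -
  have "n + 4 = Suc (Suc (Suc (Suc n)))"
    by simp
  then show ?thesis
    by (simp only: prog_of_nat.simps(5))
qed

lemma prog_of_nat_of_prog: "prog_of_nat (nat_of_prog p) = p"
proof (induction p)
  case (PPair f g)
  then show ?case
    using prog_of_nat_add4[of "4 * prod_encode (nat_of_prog f, nat_of_prog g)"] by simp
next
  case (PComp f g)
  have "(4 * k + 1) mod 4 = 1" "(4 * k + 1) div 4 = k" for k :: nat by presburger+
  then show ?case
    using PComp prog_of_nat_add4[of "4 * prod_encode (nat_of_prog f, nat_of_prog g) + 1"]
    by (simp add: add.commute)
next
  case (PRec f g)
  have "(4 * k + 2) mod 4 = 2" "(4 * k + 2) div 4 = k" for k :: nat by presburger+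
  then show ?case
    using PRec prog_of_nat_add4[of "4 * prod_encode (nat_of_prog f, nat_of_prog g) + 2"]
    by (simp add: add.commute)
next
  case (PMu f)
  have "(4 * k + 3) mod 4 = 3" "(4 * k + 3) div 4 = k" for k :: nat by presburger+
  then show ?case
    using PMu prog_of_nat_add4[of "4 * nat_of_prog f + 3"]
    by (simp add: add.commute)
qed (simp_all add: numeral_eq_Suc)

lemma nat_of_prog_of_nat: "nat_of_prog (prog_of_nat n) = n"
proof (induction n rule: prog_of_nat.induct)
  case (5 n)
  define m where "m = n div 4"
  have n: "n = 4 * m + n mod 4"
    by (simp add: m_def)
  have "n mod 4 = 0 \<or> n mod 4 = 1 \<or> n mod 4 = 2 \<or> n mod 4 = 3"
    by presburger
  then show ?case
    using 5[OF m_def refl refl] n by (auto simp: Let_def simp flip: m_def)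
qed simp_all

text \<open>The \<open>e\<close>th c.e. set, i.e. the domain of the \<open>e\<close>th partial recursive function.\<close>

definition W :: "nat \<Rightarrow> nat set" where
  "W e = {x. run (prog_of_nat e) x \<noteq> None}"

definition computable_set :: "nat set \<Rightarrow> bool" where
  "computable_set A \<longleftrightarrow> total_computable (\<lambda>x. if x \<in> A then 1 else 0)"

fun sigma0 :: "nat \<Rightarrow> nat set \<Rightarrow> bool" and pi0 :: "nat \<Rightarrow> nat set \<Rightarrow> bool" where
  "sigma0 0 A \<longleftrightarrow> computable_set A"
| "sigma0 (Suc n) A \<longleftrightarrow> (\<exists>B. pi0 n B \<and> A = {x. \<exists>y. prod_encode (x, y) \<in> B})"
| "pi0 0 A \<longleftrightarrow> computable_set A"
| "pi0 (Suc n) A \<longleftrightarrow> (\<exists>B. sigma0 n B \<and> A = {x. \<forall>y. prod_encode (x, y) \<in> B})"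

definition sigma0_rel :: "nat \<Rightarrow> nat rel \<Rightarrow> bool" where
  "sigma0_rel n E \<longleftrightarrow> sigma0 n (prod_encode ` E)"

definition pi0_rel :: "nat \<Rightarrow> nat rel \<Rightarrow> bool" where
  "pi0_rel n E \<longleftrightarrow> pi0 n (prod_encode ` E)"

definition reducible :: "nat rel \<Rightarrow> nat rel \<Rightarrow> bool" where
  "reducible E R \<longleftrightarrow>
     (\<exists>f. total_computable f \<and> (\<forall>x y. (x, y) \<in> E \<longleftrightarrow> (f x, f y) \<in> R))"

text \<open>For an equivalence relation \<open>E\<close>, the \<open>E\<close>-closure of a set \<open>S\<close> is the image \<open>E `` S\<close>.\<close>

definition jump :: "nat rel \<Rightarrow> nat rel" where
  "jump E = {(x, y). E `` W x = E `` W y}"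

definition infinite_equiv :: "nat rel \<Rightarrow> bool" where
  "infinite_equiv E \<longleftrightarrow> equiv UNIV E \<and> infinite (UNIV // E)"

end

theory Submission
  imports Defs
begin

text \<open>
  For a \<open>\<Pi>\<^sup>0\<^sub>2\<close> relation \<open>E\<close>, given by \<open>x E y \<longleftrightarrow> (\<forall>u. \<exists>v. K x y u v)\<close>, put \<open>V\<^sub>0 = {}\<close> and let \<open>n \<in> V\<^sub>i\<^sub>+\<^sub>1\<close> iff every
  \<open>x < n\<close> looks \<open>E\<close>-equivalent to some \<open>b \<in> V\<^sub>i\<close> as far as the values \<open>u < n\<close> tell. These are
  uniformly c.e. initial segments. If \<open>V\<^sub>i\<close> is finite, then an element outside its closure bounds
  \<open>V\<^sub>i\<^sub>+\<^sub>1\<close>, and the failure of \<open>Suc (Max V\<^sub>i\<^sub>+\<^sub>1)\<close> to enter yields an element of \<open>V\<^sub>i\<^sub>+\<^sub>1\<close> outside the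
  closure of \<open>V\<^sub>i\<close>. So the closures increase strictly.

  For the \<open>\<Sigma>\<^sup>0\<^sub>2\<close> example let \<open>A e n\<close> be the c.e. set with index \<open>\<phi>\<^sub>e(n)\<close>. A construction computable
  from the halting problem assigns labels to longer and longer initial segments of the numbers;
  equal labels mean equivalent. If \<open>A e n\<close> has an unlabelled element, such an element is given
  any desired label; hence an infinite \<open>A e n\<close> meets every class. If two sets \<open>A e n\<close>, \<open>A e m\<close>
  are completely labelled and have the same labels after truncation at \<open>e\<close>, all labels are
  truncated at \<open>e\<close>, and then the two closures agree forever; this happens at most once for each
  \<open>e\<close>, so each label is eventually permanent and there are infinitely many classes. If at most
  one \<open>A e n\<close> is infinite, then the pigeonhole principle supplies such a pair. The state after
  \<open>t\<close> stages is a limit of computable approximations, and this makes the relation \<open>\<Sigma>\<^sup>0\<^sub>2\<close>.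
\<close>

subsection \<open>Computable functions and decidable predicates\<close>

definition decidable :: "(nat \<Rightarrow> bool) \<Rightarrow> bool" where
  "decidable P \<longleftrightarrow> total_computable (\<lambda>z. if P z then 1 else 0)"

abbreviation pfst :: "nat \<Rightarrow> nat" where "pfst z \<equiv> fst (prod_decode z)"
abbreviation psnd :: "nat \<Rightarrow> nat" where "psnd z \<equiv> snd (prod_decode z)"

lemma ex_prod_decode: "(\<exists>t n. P t n) \<longleftrightarrow> (\<exists>w. P (pfst w) (psnd w))"
proof
  assume "\<exists>t n. P t n"
  then obtain t n where "P t n"
    by blast
  then show "\<exists>w. P (pfst w) (psnd w)"
    by (intro exI[of _ "prod_encode (t, n)"]) simp
qed blast

text \<open>Syntax-directed closure rules: introducing them repeatedly reduces an explicit
  expression to its atoms. Under a binder, the bound variable is packed together with the outer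
  argument into one number.\<close>

named_theorems comp_intros

text \<open>No basic program is the identity, but decoding a number and encoding the two halves
  again is.\<close>

lemma total_computable_id [comp_intros]: "total_computable (\<lambda>z. z)"
  unfolding total_computable_def by (rule exI[of _ "PPair PFst PSnd"]) simp

lemma total_computable_comp:
  assumes "total_computable f" "total_computable g"
  shows "total_computable (\<lambda>z. f (g z))"
proof -
  obtain p q where "\<forall>x. run p x = Some (f x)" "\<forall>x. run q x = Some (g x)"
    using assms unfolding total_computable_def by blast
  then show ?thesis
    unfolding total_computable_def by (intro exI[of _ "PComp p q"]) simp
qed

lemma total_computable_pfst [comp_intros]:
  "total_computable f \<Longrightarrow> total_computable (\<lambda>z. pfst (f z))"
  by (rule total_computable_comp[of "\<lambda>z. pfst z" f]) (auto simp: total_computable_def intro: exI[of _ PFst])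

lemma total_computable_psnd [comp_intros]:
  "total_computable f \<Longrightarrow> total_computable (\<lambda>z. psnd (f z))"
  by (rule total_computable_comp[of "\<lambda>z. psnd z" f]) (auto simp: total_computable_def intro: exI[of _ PSnd])

lemma total_computable_Suc [comp_intros]:
  "total_computable f \<Longrightarrow> total_computable (\<lambda>z. Suc (f z))"
  by (rule total_computable_comp[of Suc f]) (auto simp: total_computable_def intro: exI[of _ PSucc])

lemma total_computable_pair [comp_intros]:
  assumes "total_computable f" "total_computable g"
  shows "total_computable (\<lambda>z. prod_encode (f z, g z))"
proof -
  obtain p q where "\<forall>x. run p x = Some (f x)" "\<forall>x. run q x = Some (g x)"
    using assms unfolding total_computable_def by blast
  then show ?thesis
    unfolding total_computable_def by (intro exI[of _ "PPair p q"]) simp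
qed

lemma total_computable_const [comp_intros]: "total_computable (\<lambda>z. k)"
proof (induction k)
  case 0
  show ?case
    unfolding total_computable_def by (rule exI[of _ PZero]) simp
next
  case (Suc k)
  then show ?case
    by (rule total_computable_Suc)
qed

text \<open>The outer argument \<open>z\<close> serves as the parameter of \<open>PRec\<close>;
  since the base, the step and the counter are total, the recursion in the option type never reaches
  \<open>None\<close>.\<close>

lemma total_computable_rec [comp_intros]:
  assumes "total_computable f" "total_computable (\<lambda>w. g (pfst w) (pfst (psnd w)) (psnd (psnd w)))"
    and "total_computable n"
  shows "total_computable (\<lambda>z. rec_nat (f z) (g z) (n z))"
proof -
  obtain p q r where p: "\<forall>x. run p x = Some (f x)"
    and q: "\<forall>w. run q w = Some (g (pfst w) (pfst (psnd w)) (psnd (psnd w)))"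
    and r: "\<forall>x. run r x = Some (n x)"
    using assms unfolding total_computable_def by blast
  have "rec_nat (run p z)
          (\<lambda>m r. Option.bind r (\<lambda>v. run q (prod_encode (z, prod_encode (m, v))))) k =
        Some (rec_nat (f z) (g z) k)" for z k
    by (induction k) (simp_all add: p q)
  then show ?thesis
    unfolding total_computable_def
    by (intro exI[of _ "PComp (PRec p q) (PPair (PPair PFst PSnd) r)"]) (simp add: r)
qed

lemma total_computable_add [comp_intros]:
  assumes "total_computable f" "total_computable g"
  shows "total_computable (\<lambda>z. f z + g z)"
proof -
  have "rec_nat a (\<lambda>_ r. Suc r) b = a + b" for a b
    by (induction b) simp_all
  moreover have "total_computable (\<lambda>z. rec_nat (f z) (\<lambda>_ r. Suc r) (g z))"
    by (intro comp_intros assms)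
  ultimately show ?thesis
    by simp
qed

lemma total_computable_mult [comp_intros]:
  assumes "total_computable f" "total_computable g"
  shows "total_computable (\<lambda>z. f z * g z)"
proof -
  have "rec_nat 0 (\<lambda>_ r. r + a) b = a * b" for a b :: nat
    by (induction b) simp_all
  moreover have "total_computable (\<lambda>z. rec_nat 0 (\<lambda>_ r. r + f z) (g z))"
    by (intro comp_intros total_computable_comp[OF assms(1)] assms(2))
  ultimately show ?thesis
    by simp
qed

lemma total_computable_diff [comp_intros]:
  assumes "total_computable f" "total_computable g"
  shows "total_computable (\<lambda>z. f z - g z)"
proof -
  \<comment> \<open>A recursion that returns its own counter is the predecessor; iterating it gives
    truncated subtraction.\<close>
  have pred: "rec_nat 0 (\<lambda>m _. m) b = b - 1" for b :: nat
    by (cases b) simp_all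
  have "rec_nat a (\<lambda>_ r. rec_nat 0 (\<lambda>m _. m) r) b = a - b" for a b :: nat
    by (induction b) (simp_all add: pred)
  moreover have "total_computable (\<lambda>z. rec_nat (f z) (\<lambda>_ r. rec_nat 0 (\<lambda>m _. m) r) (g z))"
    by (intro comp_intros assms)
  ultimately show ?thesis
    by simp
qed

text \<open>A recursion of length 0 or 1 acts as a case distinction.\<close>

lemma total_computable_if [comp_intros]:
  assumes "decidable P" "total_computable f" "total_computable g"
  shows "total_computable (\<lambda>z. if P z then f z else g z)"
proof -
  have "rec_nat (g z) (\<lambda>_ _. f z) (if P z then 1 else 0) = (if P z then f z else g z)" for z
    by simp
  moreover have "total_computable (\<lambda>z. rec_nat (g z) (\<lambda>_ _. f z) (if P z then 1 else 0))"
    by (intro comp_intros total_computable_comp[OF assms(2)] assms(3) assms(1)[unfolded decidable_def])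
  ultimately show ?thesis
    by simp
qed

lemma decidable_comp:
  assumes "decidable P" "total_computable f"
  shows "decidable (\<lambda>z. P (f z))"
  using total_computable_comp[OF assms(1)[unfolded decidable_def] assms(2)]
  unfolding decidable_def .

lemma decidable_less [comp_intros]:
  assumes "total_computable f" "total_computable g"
  shows "decidable (\<lambda>z. f z < g z)"
proof -
  have "rec_nat 0 (\<lambda>_ _. 1) (b - a) = (if a < b then 1 else 0::nat)" for a b :: nat
    by (cases "b - a") auto
  moreover have "total_computable (\<lambda>z. rec_nat 0 (\<lambda>_ _. 1) (g z - f z))"
    by (intro comp_intros assms)
  ultimately show ?thesis
    unfolding decidable_def by simp
qed

lemma decidable_not [comp_intros]:
  assumes "decidable P"
  shows "decidable (\<lambda>z. \<not> P z)"
proof -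
  have "total_computable (\<lambda>z. if P z then 0 else 1)"
    by (intro comp_intros assms)
  moreover have "(if P z then 0 else 1) = (if \<not> P z then 1 else 0::nat)" for z
    by simp
  ultimately show ?thesis
    unfolding decidable_def by simp
qed

lemma decidable_conj [comp_intros]:
  assumes "decidable P" "decidable Q"
  shows "decidable (\<lambda>z. P z \<and> Q z)"
proof -
  have "total_computable (\<lambda>z. if P z then (if Q z then 1 else 0) else 0)"
    by (intro comp_intros assms)
  moreover have "(if P z then (if Q z then 1 else 0) else 0) = (if P z \<and> Q z then 1 else 0::nat)" for z
    by simp
  ultimately show ?thesis
    unfolding decidable_def by simp
qed

lemma decidable_disj [comp_intros]:
  assumes "decidable P" "decidable Q"
  shows "decidable (\<lambda>z. P z \<or> Q z)"
  using decidable_not[OF decidable_conj[OF decidable_not[OF assms(1)] decidable_not[OF assms(2)]]]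
  by simp

lemma decidable_imp [comp_intros]:
  assumes "decidable P" "decidable Q"
  shows "decidable (\<lambda>z. P z \<longrightarrow> Q z)"
  using decidable_disj[OF decidable_not[OF assms(1)] assms(2)] by simp

lemma decidable_le [comp_intros]:
  assumes "total_computable f" "total_computable g"
  shows "decidable (\<lambda>z. f z \<le> g z)"
  using decidable_not[OF decidable_less[OF assms(2,1)]] by (simp add: not_less)

lemma decidable_eq [comp_intros]:
  assumes "total_computable f" "total_computable g"
  shows "decidable (\<lambda>z. f z = g z)"
  using decidable_conj[OF decidable_le[OF assms] decidable_le[OF assms(2,1)]]
  by (simp add: eq_iff)

lemma decidable_bex [comp_intros]:
  assumes "decidable (\<lambda>w. P (pfst w) (psnd w))" "total_computable n"
  shows "decidable (\<lambda>z. \<exists>i<n z. P z i)"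
proof -
  have "rec_nat 0 (\<lambda>i r. if P z i then 1 else r) k = (if \<exists>i<k. P z i then 1 else 0::nat)" for z k
    by (induction k) (auto simp: less_Suc_eq)
  moreover have "decidable (\<lambda>w. P (pfst w) (pfst (psnd w)))"
    using decidable_comp[OF assms(1) total_computable_pair[OF total_computable_pfst[OF total_computable_id]
        total_computable_pfst[OF total_computable_psnd[OF total_computable_id]]]]
    by simp
  then have "total_computable (\<lambda>z. rec_nat 0 (\<lambda>i r. if P z i then 1 else r) (n z))"
    by (intro comp_intros assms)
  ultimately show ?thesis
    unfolding decidable_def by simp
qed

lemma decidable_ball [comp_intros]:
  assumes "decidable (\<lambda>w. P (pfst w) (psnd w))" "total_computable n"
  shows "decidable (\<lambda>z. \<forall>i<n z. P z i)"
  using decidable_not[OF decidable_bex[OF decidable_not[OF assms(1)] assms(2)]] by simp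

lemma total_computable_min [comp_intros]:
  assumes "total_computable f" "total_computable g"
  shows "total_computable (\<lambda>z. min (f z) (g z))"
  unfolding min_def by (intro comp_intros assms)

text \<open>The disjunct \<open>i = n\<close> makes the search total: the value \<open>n\<close>
  signals that no number below \<open>n\<close> satisfies \<open>P\<close>.\<close>

definition bounded_least :: "(nat \<Rightarrow> bool) \<Rightarrow> nat \<Rightarrow> nat" where
  "bounded_least P n = (LEAST i. i = n \<or> P i)"

lemma bounded_least_le: "bounded_least P n \<le> n"
  unfolding bounded_least_def by (rule Least_le) simp

lemma bounded_least_le_witness: "P i \<Longrightarrow> bounded_least P n \<le> i"
  unfolding bounded_least_def by (rule Least_le) simp

lemma bounded_least_less: "bounded_least P n < n \<Longrightarrow> P (bounded_least P n)"
  unfolding bounded_least_def using LeastI[of "\<lambda>i. i = n \<or> P i" n] by auto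

lemma less_bounded_least: "i < bounded_least P n \<Longrightarrow> \<not> P i"
  unfolding bounded_least_def using not_less_Least by blast

lemma bounded_least_eqI:
  assumes "i \<le> n" "i < n \<Longrightarrow> P i" "\<And>j. j < i \<Longrightarrow> \<not> P j"
  shows "bounded_least P n = i"
  unfolding bounded_least_def
proof (rule Least_equality)
  show "i = n \<or> P i"
    using assms(1,2) le_neq_implies_less by blast
  show "i \<le> j" if "j = n \<or> P j" for j
    using that assms(1,3) leI by blast
qed

lemma total_computable_bounded_least [comp_intros]:
  assumes "decidable (\<lambda>w. P (pfst w) (psnd w))" "total_computable n"
  shows "total_computable (\<lambda>z. bounded_least (P z) (n z))"
proof -
  \<comment> \<open>Before step \<open>i\<close> the accumulator is either the least witness,
    recognised by \<open>r < i\<close>, or equal to \<open>i\<close> if none has been found.\<close>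
  have "rec_nat 0 (\<lambda>i r. if r < i then r else if P z i then i else Suc i) k = bounded_least (P z) k"
    for z k
  proof (induction k)
    case (Suc k)
    consider "bounded_least (P z) k < k" | "bounded_least (P z) k = k"
      using bounded_least_le[of "P z" k] by linarith
    then show ?case
    proof cases
      case 1
      then have "bounded_least (P z) (Suc k) = bounded_least (P z) k"
        by (intro bounded_least_eqI) (auto dest: bounded_least_less less_bounded_least)
      then show ?thesis
        using 1 Suc by simp
    next
      case 2
      then have "\<not> P z j" if "j < k" for j
        using that less_bounded_least[of j "P z" k] by simp
      then have "bounded_least (P z) (Suc k) = (if P z k then k else Suc k)"
        by (intro bounded_least_eqI) (auto simp: less_Suc_eq split: if_splits)
      then show ?thesis
        using 2 Suc by simp
    qed
  qed (simp add: bounded_least_def)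
  moreover have "decidable (\<lambda>w. P (pfst w) (pfst (psnd w)))"
    using decidable_comp[OF assms(1) total_computable_pair[OF total_computable_pfst[OF total_computable_id]
        total_computable_pfst[OF total_computable_psnd[OF total_computable_id]]]]
    by simp
  then have "total_computable
      (\<lambda>z. rec_nat 0 (\<lambda>i r. if r < i then r else if P z i then i else Suc i) (n z))"
    by (intro comp_intros assms)
  ultimately show ?thesis
    by simp
qed

section \<open>Coded tables and course-of-values recursion\<close>

definition tabulate :: "(nat \<Rightarrow> nat) \<Rightarrow> nat \<Rightarrow> nat" where
  "tabulate f n = rec_nat 0 (\<lambda>m r. prod_encode (f m, r)) n"

text \<open>The latest entry is outermost, so entry \<open>i\<close> lies under
  \<open>n - Suc i\<close> tails. The table does not record its length \<open>n\<close>, which is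
  therefore an argument.\<close>

definition lookup :: "nat \<Rightarrow> nat \<Rightarrow> nat \<Rightarrow> nat" where
  "lookup n l i = pfst (rec_nat l (\<lambda>_. psnd) (n - Suc i))"

lemma lookup_tabulate: "i < n \<Longrightarrow> lookup n (tabulate f n) i = f i"
proof -
  have "rec_nat (tabulate f (k + m)) (\<lambda>_. psnd) k = tabulate f m" for k m
  proof (induction k arbitrary: m)
    case (Suc k)
    show ?case
      using Suc[of "Suc m"] by (simp add: tabulate_def)
  qed simp
  from this[of "n - Suc i" "Suc i"] show "i < n \<Longrightarrow> lookup n (tabulate f n) i = f i"
    by (simp add: lookup_def tabulate_def)
qed

lemma total_computable_tabulate [comp_intros]:
  assumes "total_computable (\<lambda>w. f (pfst w) (psnd w))" "total_computable n"
  shows "total_computable (\<lambda>z. tabulate (f z) (n z))"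
proof -
  have "total_computable (\<lambda>w. f (pfst w) (pfst (psnd w)))"
    using total_computable_comp[OF assms(1) total_computable_pair[OF total_computable_pfst[OF total_computable_id]
        total_computable_pfst[OF total_computable_psnd[OF total_computable_id]]]]
    by simp
  then show ?thesis
    unfolding tabulate_def by (intro comp_intros assms)
qed

lemma total_computable_lookup [comp_intros]:
  assumes "total_computable n" "total_computable l" "total_computable i"
  shows "total_computable (\<lambda>z. lookup (n z) (l z) (i z))"
  unfolding lookup_def by (intro comp_intros assms)

text \<open>The table of values obeys an ordinary primitive recursion whose new entry is given by
  \<open>\<Phi>\<close>; one further application of \<open>\<Phi>\<close> then yields
  \<open>f\<close>.\<close>

lemma total_computable_course_of_values:
  assumes "total_computable (\<lambda>w. \<Phi> (pfst w) (psnd w))" "\<And>n. f n = \<Phi> n (tabulate f n)"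
  shows "total_computable f"
proof -
  have tab: "tabulate f n = rec_nat 0 (\<lambda>m r. prod_encode (\<Phi> m r, r)) n" for n
  proof (induction n)
    case (Suc n)
    then show ?case
      using assms(2)[of n] by (simp add: tabulate_def)
  qed (simp add: tabulate_def)
  have "total_computable (\<lambda>w. \<Phi> (pfst (psnd w)) (psnd (psnd w)))"
    using total_computable_comp[OF assms(1), of psnd] total_computable_psnd[OF total_computable_id]
    by simp
  then have "total_computable (\<lambda>n. tabulate f n)"
    unfolding tab by (intro comp_intros)
  from total_computable_comp[OF assms(1) total_computable_pair[OF total_computable_id this]]
  show ?thesis
    by (simp flip: assms(2))
qed

subsection \<open>Infinite \<open>\<Pi>\<^sup>0\<^sub>2\<close> equivalence relations\<close>

primrec const_prog :: "nat \<Rightarrow> prog" where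
  "const_prog 0 = PZero"
| "const_prog (Suc k) = PComp PSucc (const_prog k)"

lemma run_const_prog: "run (const_prog k) x = Some k"
  by (induction k) simp_all

lemma total_computable_nat_of_const_prog [comp_intros]:
  "total_computable (\<lambda>k. nat_of_prog (const_prog k))"
proof -
  have "nat_of_prog (const_prog k) = rec_nat 0 (\<lambda>_ r. 4 * prod_encode (1, r) + 5) k" for k
    by (induction k) simp_all
  moreover have "total_computable (\<lambda>k. rec_nat 0 (\<lambda>_ r. 4 * prod_encode (1, r) + 5) k)"
    by (intro comp_intros)
  ultimately show ?thesis
    by simp
qed

text \<open>An instance of the s-m-n theorem: \<open>i\<close> is hardwired by
  \<open>const_prog\<close>, and the program searches for a witness \<open>s\<close>, so it halts
  exactly if there is one. The test \<open>q\<close> returns 0 for success because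
  \<open>PMu\<close> looks for a zero.\<close>

lemma uniformly_ce_index:
  assumes "decidable (\<lambda>w. P (pfst (pfst w)) (psnd (pfst w)) (psnd w))"
  shows "\<exists>f. total_computable f \<and> (\<forall>i. W (f i) = {n. \<exists>s. P i n s})"
proof -
  have "total_computable (\<lambda>w. if P (pfst (pfst w)) (psnd (pfst w)) (psnd w) then 0 else 1)"
    by (intro comp_intros assms)
  then obtain q where
    q: "\<And>w. run q w = Some (if P (pfst (pfst w)) (psnd (pfst w)) (psnd w) then 0 else 1)"
    unfolding total_computable_def by blast
  define f where "f i = nat_of_prog (PComp (PMu q) (PPair (const_prog i) (PPair PFst PSnd)))" for i
  have least: "\<exists>s. P i n s \<and> (\<forall>m<s. \<not> P i n m)" if "P i n s" for i n s
    using LeastI[of "P i n", OF that] not_less_Least[of _ "P i n"] by blast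
  have "run (PMu q) (prod_encode (i, n)) \<noteq> None \<longleftrightarrow> (\<exists>s. P i n s)" for i n
  proof -
    have "run q (prod_encode (prod_encode (i, n), s)) = Some 0 \<and>
        (\<forall>m<s. \<exists>v>0. run q (prod_encode (prod_encode (i, n), m)) = Some v) \<longleftrightarrow>
        P i n s \<and> (\<forall>m<s. \<not> P i n m)" for s
      by (auto simp: q)
    then have "run (PMu q) (prod_encode (i, n)) \<noteq> None \<longleftrightarrow> (\<exists>s. P i n s \<and> (\<forall>m<s. \<not> P i n m))"
      unfolding run.simps Let_def by (simp only: if_split) auto
    then show ?thesis
      using least by blast
  qed
  then have "W (f i) = {n. \<exists>s. P i n s}" for i
    by (simp add: W_def f_def prog_of_nat_of_prog run_const_prog del: run.simps(8) nat_of_prog.simps)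
  moreover have "total_computable f"
    unfolding f_def nat_of_prog.simps by (intro comp_intros)
  ultimately show ?thesis
    by blast
qed

section \<open>Uniformly c.e. initial segments\<close>

definition related_below :: "(nat \<Rightarrow> nat \<Rightarrow> nat \<Rightarrow> nat \<Rightarrow> bool) \<Rightarrow> nat \<Rightarrow> nat \<Rightarrow> nat \<Rightarrow> bool" where
  "related_below K r s n \<longleftrightarrow> (\<forall>x<n. \<exists>b<r. \<forall>u<n. \<exists>v<s. K x b u v)"

text \<open>The length of the stage \<open>s\<close> approximation to the \<open>i\<close>th initial
  segment. Cutting both the search and the witnesses \<open>v\<close> at \<open>s\<close> keeps
  everything decidable.\<close>

definition seg :: "(nat \<Rightarrow> nat \<Rightarrow> nat \<Rightarrow> nat \<Rightarrow> bool) \<Rightarrow> nat \<Rightarrow> nat \<Rightarrow> nat" where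
  "seg K s i = rec_nat 0 (\<lambda>_ r. bounded_least (\<lambda>n. \<not> related_below K r s n) s) i"

lemma seg_simps [simp]:
  "seg K s 0 = 0"
  "seg K s (Suc i) = bounded_least (\<lambda>n. \<not> related_below K (seg K s i) s n) s"
  by (simp_all add: seg_def)

lemma related_below_mono:
  "related_below K r s n \<Longrightarrow> r \<le> r' \<Longrightarrow> s \<le> s' \<Longrightarrow> n' \<le> n \<Longrightarrow> related_below K r' s' n'"
  unfolding related_below_def by (meson order_less_le_trans)

text \<open>Enlarging \<open>r\<close> and \<open>s\<close> only helps \<open>related_below\<close>,
  so the first failure at the later stage is already a failure at the earlier one.\<close>

lemma seg_mono: "s \<le> s' \<Longrightarrow> seg K s i \<le> seg K s' i"
proof (induction i)
  case (Suc i)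
  let ?j = "seg K s' (Suc i)"
  show ?case
  proof (cases "?j < s")
    case True
    then have "\<not> related_below K (seg K s' i) s' ?j"
      using bounded_least_less[of "\<lambda>n. \<not> related_below K (seg K s' i) s' n" s'] Suc.prems
      by simp
    then have "\<not> related_below K (seg K s i) s ?j"
      using related_below_mono Suc by blast
    then show ?thesis
      unfolding seg_simps(2)[of K s] by (rule bounded_least_le_witness)
  next
    case False
    then show ?thesis
      using bounded_least_le[of _ s] by (metis seg_simps(2) not_less order_trans)
  qed
qed simp

definition segs :: "(nat \<Rightarrow> nat \<Rightarrow> nat \<Rightarrow> nat \<Rightarrow> bool) \<Rightarrow> nat \<Rightarrow> nat set" where
  "segs K i = {n. \<exists>s. n < seg K s i}"

lemma segs_0 [simp]: "segs K 0 = {}"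
  by (simp add: segs_def)

lemma segs_eventually: "n \<in> segs K i \<Longrightarrow> \<forall>\<^sub>F s in sequentially. n < seg K s i"
  unfolding segs_def eventually_sequentially using seg_mono order_less_le_trans by blast

text \<open>For fixed \<open>n\<close> the right-hand side asks for finitely many confirmations,
  each of which holds at all late stages; hence one stage \<open>s > n\<close> confirms them
  together. Smaller numbers satisfy weaker conditions, so the search passes
  \<open>n\<close>.\<close>

lemma segs_Suc:
  "n \<in> segs K (Suc i) \<longleftrightarrow> (\<forall>x<n. \<exists>b\<in>segs K i. \<forall>u<n. \<exists>v. K x b u v)"
proof
  assume "n \<in> segs K (Suc i)"
  then obtain s where "n < seg K s (Suc i)"
    by (auto simp: segs_def)
  then have "related_below K (seg K s i) s n"
    using less_bounded_least by fastforce
  then show "\<forall>x<n. \<exists>b\<in>segs K i. \<forall>u<n. \<exists>v. K x b u v"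
    unfolding related_below_def segs_def by blast
next
  assume *: "\<forall>x<n. \<exists>b\<in>segs K i. \<forall>u<n. \<exists>v. K x b u v"
  have "\<forall>\<^sub>F s in sequentially. \<exists>b<seg K s i. \<forall>u<n. \<exists>v<s. K x b u v" if "x < n" for x
  proof -
    obtain b where b: "b \<in> segs K i" "\<forall>u<n. \<exists>v. K x b u v"
      using * \<open>x < n\<close> by blast
    have "\<forall>\<^sub>F s in sequentially. \<exists>v<s. K x b u v" if "u \<in> {..<n}" for u
    proof -
      obtain v where "K x b u v"
        using b(2) \<open>u \<in> {..<n}\<close> by blast
      then show ?thesis
        by (intro eventually_mono[OF eventually_gt_at_top[of v]]) blast
    qed
    then have "\<forall>\<^sub>F s in sequentially. \<forall>u\<in>{..<n}. \<exists>v<s. K x b u v"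
      by (intro eventually_ball_finite) auto
    with segs_eventually[OF b(1)] show ?thesis
      by eventually_elim auto
  qed
  then have "\<forall>\<^sub>F s in sequentially. \<forall>x\<in>{..<n}. \<exists>b<seg K s i. \<forall>u<n. \<exists>v<s. K x b u v"
    by (intro eventually_ball_finite) auto
  then have "\<forall>\<^sub>F s in sequentially. related_below K (seg K s i) s n \<and> n < s"
    using eventually_gt_at_top[of n]
    by eventually_elim (auto simp: related_below_def)
  then obtain s where s: "related_below K (seg K s i) s n" "n < s"
    using eventually_happens'[OF sequentially_bot] by blast
  have "n < seg K s (Suc i)"
  proof (rule ccontr)
    assume "\<not> n < seg K s (Suc i)"
    then have le: "seg K s (Suc i) \<le> n"
      by simp
    then have "\<not> related_below K (seg K s i) s (seg K s (Suc i))"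
      using bounded_least_less[of "\<lambda>n. \<not> related_below K (seg K s i) s n" s] s(2) by simp
    then show False
      using related_below_mono[OF s(1) order_refl order_refl le] by blast
  qed
  then show "n \<in> segs K (Suc i)"
    by (auto simp: segs_def)
qed

lemma segs_downward: "n \<in> segs K i \<Longrightarrow> m \<le> n \<Longrightarrow> m \<in> segs K i"
  unfolding segs_def using le_less_trans by blast

lemma total_computable_seg:
  assumes "decidable (\<lambda>w. K (pfst (pfst (pfst w))) (psnd (pfst (pfst w))) (psnd (pfst w)) (psnd w))"
    and "total_computable s" "total_computable i"
  shows "total_computable (\<lambda>z. seg K (s z) (i z))"
proof -
  have K: "decidable (\<lambda>z. K (f z) (g z) (h z) (k z))"
    if "total_computable f" "total_computable g" "total_computable h" "total_computable k" for f g h k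
    using decidable_comp[OF assms(1), of "\<lambda>z. prod_encode (prod_encode (prod_encode (f z, g z), h z), k z)"]
      that by (simp add: total_computable_pair)
  have s: "total_computable (\<lambda>z. s (f z))" if "total_computable f" for f
    using total_computable_comp[OF assms(2) that] .
  show ?thesis
    unfolding seg_def related_below_def by (intro comp_intros K s assms(3))
qed

text \<open>The classes of the elements of a covering set exhaust the quotient.\<close>

lemma infinite_equiv_not_covered:
  assumes "infinite_equiv E" "finite A"
  shows "\<exists>x. x \<notin> E `` A"
proof (rule ccontr)
  assume "\<nexists>x. x \<notin> E `` A"
  then have "\<exists>a\<in>A. (a, x) \<in> E" for x
    by blast
  then have "UNIV // E \<subseteq> (\<lambda>a. E `` {a}) ` A"
    using assms(1) unfolding infinite_equiv_def quotient_def
    by (auto simp: image_iff) (metis equiv_class_eq)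
  then show False
    using assms finite_subset unfolding infinite_equiv_def by blast
qed

theorem infinite_pi2_reducible:
  assumes "infinite_equiv E" "pi0_rel 2 E"
  shows "reducible Id (jump E)"
proof -
  obtain C where C: "computable_set C"
    and EC: "prod_encode ` E = {x. \<forall>u. \<exists>v. prod_encode (prod_encode (x, u), v) \<in> C}"
    using assms(2) by (auto simp: pi0_rel_def numeral_2_eq_2)
  define K where "K x y u v \<longleftrightarrow> prod_encode (prod_encode (prod_encode (x, y), u), v) \<in> C" for x y u v
  have E: "(x, y) \<in> E \<longleftrightarrow> (\<forall>u. \<exists>v. K x y u v)" for x y
  proof -
    have "(x, y) \<in> E \<longleftrightarrow> prod_encode (x, y) \<in> prod_encode ` E"
      by (auto dest: injD[OF inj_prod_encode])
    then show ?thesis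
      by (simp add: EC K_def)
  qed
  have refl: "(x, x) \<in> E" and sym: "(x, y) \<in> E \<Longrightarrow> (y, x) \<in> E" for x y
    using assms(1) unfolding infinite_equiv_def equiv_def refl_on_def sym_def by blast+
  have decK: "decidable (\<lambda>w. K (pfst (pfst (pfst w))) (psnd (pfst (pfst w))) (psnd (pfst w)) (psnd w))"
    using C by (simp add: K_def computable_set_def decidable_def)
  have new: "\<exists>x\<in>segs K (Suc i). x \<notin> E `` segs K i" and fin: "finite (segs K (Suc i))"
    if fin_i: "finite (segs K i)" for i
  proof -
    obtain x where x: "x \<notin> E `` segs K i"
      using infinite_equiv_not_covered[OF assms(1) fin_i] by blast
    have "\<exists>u. \<forall>v. \<not> K x b u v" if "b \<in> segs K i" for b
      using x that E sym by blast
    \<comment> \<open>\<open>u b\<close> is a value at which the \<Pi>-condition for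
      \<open>x\<close> and \<open>b\<close> fails.\<close>
    then obtain u where u: "\<And>b v. b \<in> segs K i \<Longrightarrow> \<not> K x b (u b) v"
      by metis
    obtain N where N: "\<And>b. b \<in> segs K i \<Longrightarrow> u b < N"
      using finite_imageI[OF fin_i, of u] by (auto simp: finite_nat_set_iff_bounded)
    \<comment> \<open>A number \<open>n \<ge> M\<close> exceeds \<open>x\<close> and every
      \<open>u b\<close>, so at \<open>n\<close> the point \<open>x\<close> no longer looks
      equivalent to any \<open>b\<close> in the segment.\<close>
    define M where "M = Suc (max x N)"
    have "n < M" if "n \<in> segs K (Suc i)" for n
      using that u N unfolding segs_Suc M_def
      by (metis less_Suc_eq_le max.strict_boundedE not_le order_less_trans)
    then show fin: "finite (segs K (Suc i))"
      by (meson finite_nat_set_iff_bounded)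
    have "0 \<in> segs K (Suc i)"
      by (simp add: segs_Suc)
    define m where "m = Max (segs K (Suc i))"
    have m: "m \<in> segs K (Suc i)"
      unfolding m_def using fin \<open>0 \<in> segs K (Suc i)\<close> by (intro Max_in) auto
    have "Suc m \<notin> segs K (Suc i)"
      using Max_ge[OF fin, of "Suc m"] by (auto simp: m_def)
    \<comment> \<open>The failure at \<open>Suc m\<close> is caused by some
      \<open>y \<le> m\<close>, which itself lies in the new segment and is equivalent to nothing in
      the old one.\<close>
    then obtain y where "y < Suc m" "\<forall>b\<in>segs K i. \<not> (\<forall>u. \<exists>v. K y b u v)"
      unfolding segs_Suc by blast
    moreover from this have "y \<in> segs K (Suc i)"
      using segs_downward[OF m] by simp
    ultimately show "\<exists>x\<in>segs K (Suc i). x \<notin> E `` segs K i"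
      using E sym by blast
  qed
  have finite_segs: "finite (segs K i)" for i
    by (induction i) (auto intro: fin)
  have "segs K i \<subseteq> segs K (Suc i)" for i
  proof -
    obtain x where "x \<in> segs K (Suc i)" "x \<notin> segs K i"
      using new[OF finite_segs] refl by blast
    \<comment> \<open>Initial segments are comparable, so a single new element decides the direction
      of inclusion.\<close>
    then show ?thesis
      by (meson linear segs_downward subsetI)
  qed
  then have mono: "i \<le> j \<Longrightarrow> segs K i \<subseteq> segs K j" for i j
    by (rule lift_Suc_mono_le)
  have less: "E `` segs K i \<noteq> E `` segs K j" if "i < j" for i j
  proof -
    obtain x where "x \<in> segs K (Suc i)" "x \<notin> E `` segs K i"
      using new[OF finite_segs] by blast
    moreover have "segs K (Suc i) \<subseteq> segs K j"
      using mono that by simp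
    ultimately show ?thesis
      using refl by blast
  qed
  have "E `` segs K i = E `` segs K j \<longleftrightarrow> i = j" for i j
    using less[of i j] less[of j i] by (metis linorder_neqE_nat)
  moreover have "decidable (\<lambda>w. psnd (pfst w) < seg K (psnd w) (pfst (pfst w)))"
    by (intro comp_intros total_computable_seg decK)
  then obtain f where "total_computable f" "\<And>i. W (f i) = segs K i"
    using uniformly_ce_index[of "\<lambda>i n s. n < seg K s i"] unfolding segs_def by blast
  ultimately show ?thesis
    unfolding reducible_def jump_def by auto
qed

subsection \<open>Enumerating the values of all programs\<close>

text \<open>One inference step of the evaluation rules, with \<open>M\<close> as the set of known
  facts. Subprogram codes are bounded by \<open>e\<close> and intermediate values by
  \<open>s\<close>, so that the step is decidable relative to \<open>M\<close>.\<close>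

definition derivable ::
  "(nat \<Rightarrow> nat \<Rightarrow> nat \<Rightarrow> bool) \<Rightarrow> nat \<Rightarrow> nat \<Rightarrow> nat \<Rightarrow> nat \<Rightarrow> bool" where
  "derivable M s e x y \<longleftrightarrow>
     e = 0 \<and> y = 0 \<or> e = 1 \<and> y = Suc x \<or> e = 2 \<and> y = pfst x \<or> e = 3 \<and> y = psnd x \<or>
     (\<exists>a<e. \<exists>b<e. e = 4 * prod_encode (a, b) + 4 \<and> M a x (pfst y) \<and> M b x (psnd y)) \<or>
     (\<exists>a<e. \<exists>b<e. e = 4 * prod_encode (a, b) + 5 \<and> (\<exists>z<s. M b x z \<and> M a z y)) \<or>
     (\<exists>a<e. \<exists>b<e. e = 4 * prod_encode (a, b) + 6 \<and>
        (psnd x = 0 \<and> M a (pfst x) y \<or>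
         (\<exists>k<psnd x. psnd x = Suc k \<and> (\<exists>v<s. M e (prod_encode (pfst x, k)) v \<and>
            M b (prod_encode (pfst x, prod_encode (k, v))) y)))) \<or>
     (\<exists>a<e. e = 4 * a + 7 \<and> M a (prod_encode (x, y)) 0 \<and>
        (\<forall>m<y. \<exists>v<s. M a (prod_encode (x, m)) (Suc v)))"

lemma prog_of_nat_eqs:
  "prog_of_nat (4 * prod_encode (a, b) + 4) = PPair (prog_of_nat a) (prog_of_nat b)"
  "prog_of_nat (4 * prod_encode (a, b) + 5) = PComp (prog_of_nat a) (prog_of_nat b)"
  "prog_of_nat (4 * prod_encode (a, b) + 6) = PRec (prog_of_nat a) (prog_of_nat b)"
  "prog_of_nat (4 * a + 7) = PMu (prog_of_nat a)"
  using prog_of_nat_of_prog[of "PPair (prog_of_nat a) (prog_of_nat b)"]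
    prog_of_nat_of_prog[of "PComp (prog_of_nat a) (prog_of_nat b)"]
    prog_of_nat_of_prog[of "PRec (prog_of_nat a) (prog_of_nat b)"]
    prog_of_nat_of_prog[of "PMu (prog_of_nat a)"]
  by (simp_all add: nat_of_prog_of_nat)

lemma run_PRec:
  "run (PRec f g) (prod_encode (a, 0)) = run f a"
  "run (PRec f g) (prod_encode (a, Suc k)) =
     Option.bind (run (PRec f g) (prod_encode (a, k))) (\<lambda>v. run g (prod_encode (a, prod_encode (k, v))))"
  by simp_all

lemma run_PMu_eq_Some:
  "run (PMu f) x = Some y \<longleftrightarrow> run f (prod_encode (x, y)) = Some 0 \<and>
     (\<forall>m<y. \<exists>v. run f (prod_encode (x, m)) = Some (Suc v))"
proof -
  define P where "P n \<longleftrightarrow> run f (prod_encode (x, n)) = Some 0 \<and>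
     (\<forall>m<n. \<exists>v>0. run f (prod_encode (x, m)) = Some v)" for n
  have P_eq: "P n \<longleftrightarrow> run f (prod_encode (x, n)) = Some 0 \<and>
     (\<forall>m<n. \<exists>v. run f (prod_encode (x, m)) = Some (Suc v))" for n
    unfolding P_def by (metis gr0_conv_Suc)
  have unique: "n = m" if "P n" "P m" for n m
  proof (rule ccontr)
    assume "n \<noteq> m"
    then consider "n < m" | "m < n"
      by linarith
    then show False
      using that by cases (fastforce simp: P_def)+
  qed
  have "run (PMu f) x = (if \<exists>n. P n then Some (LEAST n. P n) else None)"
    unfolding P_def by (simp only: run.simps Let_def)
  then have "run (PMu f) x = Some y \<longleftrightarrow> P y"
    using unique by (metis LeastI option.distinct(1) option.inject)
  then show ?thesis
    by (simp only: P_eq)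
qed

lemma derivable_sound:
  assumes M: "\<And>e x y. M e x y \<Longrightarrow> run (prog_of_nat e) x = Some y"
    and "derivable M s e x y"
  shows "run (prog_of_nat e) x = Some y"
  using assms(2) unfolding derivable_def
proof (elim disjE exE conjE)
  fix a b assume "e = 4 * prod_encode (a, b) + 6" "psnd x = 0" "M a (pfst x) y"
  then show ?thesis
    using M run_PRec(1)[of "prog_of_nat a" "prog_of_nat b" "pfst x"]
    by (metis prod.collapse prod_decode_inverse prog_of_nat_eqs(3))
next
  fix a b k v assume e: "e = 4 * prod_encode (a, b) + 6" and k: "psnd x = Suc k"
    and "M e (prod_encode (pfst x, k)) v" "M b (prod_encode (pfst x, prod_encode (k, v))) y"
  then have "run (prog_of_nat e) (prod_encode (pfst x, k)) = Some v"
    "run (prog_of_nat b) (prod_encode (pfst x, prod_encode (k, v))) = Some y"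
    using M by blast+
  then have "run (prog_of_nat e) (prod_encode (pfst x, Suc k)) = Some y"
    unfolding e prog_of_nat_eqs run_PRec(2) by (simp del: run.simps)
  then show ?thesis
    by (metis k prod.collapse prod_decode_inverse)
next
  fix a assume "e = 4 * a + 7" "M a (prod_encode (x, y)) 0"
    "\<forall>m<y. \<exists>v<s. M a (prod_encode (x, m)) (Suc v)"
  then show ?thesis
    using M by (auto simp: prog_of_nat_eqs run_PMu_eq_Some simp del: run.simps)
next
  fix a b assume "e = 4 * prod_encode (a, b) + 4" "M a x (pfst y)" "M b x (psnd y)"
  then show ?thesis
    using M[of a x] M[of b x] by (simp add: prog_of_nat_eqs del: prog_of_nat.simps)
next
  fix a b z assume "e = 4 * prod_encode (a, b) + 5" "M b x z" "M a z y"
  then show ?thesis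
    using M[of b x z] M[of a z y] by (simp add: prog_of_nat_eqs del: prog_of_nat.simps)
qed (simp_all add: numeral_eq_Suc)

text \<open>
  The candidate examined at stage \<open>s\<close> is the first component of \<open>s\<close>, so every candidate recurs
  at arbitrarily late stages.
\<close>

primrec facts :: "nat \<Rightarrow> nat set" where
  "facts 0 = {}"
| "facts (Suc s) =
     (if derivable (\<lambda>e x y. prod_encode (e, prod_encode (x, y)) \<in> facts s) s
           (pfst (pfst s)) (pfst (psnd (pfst s))) (psnd (psnd (pfst s)))
      then insert (pfst s) (facts s) else facts s)"

definition evaluates :: "nat \<Rightarrow> nat \<Rightarrow> nat \<Rightarrow> nat \<Rightarrow> bool" where
  "evaluates s e x y \<longleftrightarrow> prod_encode (e, prod_encode (x, y)) \<in> facts s"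

lemma evaluates_sound: "evaluates s e x y \<Longrightarrow> run (prog_of_nat e) x = Some y"
proof (induction s arbitrary: e x y)
  case (Suc s)
  let ?M = "\<lambda>e x y. prod_encode (e, prod_encode (x, y)) \<in> facts s"
  have "run (prog_of_nat e) x = Some y" if "derivable ?M s e x y"
    using derivable_sound[OF _ that] Suc.IH by (simp add: evaluates_def)
  moreover have "derivable ?M s e x y \<or> evaluates s e x y"
  proof (cases "prod_encode (e, prod_encode (x, y)) = pfst s")
    case True
    then show ?thesis
      using Suc.prems by (auto simp: evaluates_def simp flip: True split: if_splits)
  next
    case False
    then show ?thesis
      using Suc.prems by (auto simp: evaluates_def split: if_splits)
  qed
  ultimately show ?case
    using Suc.IH by blast
qed (simp add: evaluates_def)

lemma evaluates_mono:
  assumes "evaluates s e x y" "s \<le> s'"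
  shows "evaluates s' e x y"
proof -
  have "facts n \<subseteq> facts (Suc n)" for n
    by auto
  then have "facts s \<subseteq> facts s'"
    using assms(2) by (rule lift_Suc_mono_le)
  then show ?thesis
    using assms(1) unfolding evaluates_def by blast
qed

text \<open>The candidate added at stage \<open>s\<close> is \<open>pfst s \<le> s\<close>, and
  \<open>y\<close> is at most its code. This supplies the bounds on intermediate values in
  \<open>derivable\<close>.\<close>

lemma evaluates_less: "evaluates s e x y \<Longrightarrow> y < s"
proof -
  have "c < s" if "c \<in> facts s" for c
    using that fst_prod_decode_le[of s]
    by (induction s) (auto split: if_splits intro: less_SucI le_imp_less_Suc fst_prod_decode_le)
  moreover have "y \<le> prod_encode (e, prod_encode (x, y))"
    using le_prod_encode_2 order_trans by blast
  ultimately show "evaluates s e x y \<Longrightarrow> y < s"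
    unfolding evaluates_def using le_less_trans by blast
qed

lemma evaluates_eventually: "evaluates s e x y \<Longrightarrow> \<forall>\<^sub>F s in sequentially. evaluates s e x y"
  unfolding eventually_sequentially using evaluates_mono by blast

text \<open>The stage pairing the candidate with \<open>N\<close> examines this candidate and is at
  least \<open>N\<close>.\<close>

lemma derivable_imp_evaluates:
  assumes "\<forall>\<^sub>F s in sequentially. derivable (evaluates s) s e x y"
  shows "\<exists>s. evaluates s e x y"
proof -
  obtain N where N: "\<And>s. s \<ge> N \<Longrightarrow> derivable (evaluates s) s e x y"
    using assms unfolding eventually_sequentially by blast
  let ?s = "prod_encode (prod_encode (e, prod_encode (x, y)), N)"
  have "derivable (evaluates ?s) ?s e x y"
    by (rule N) (rule le_prod_encode_2)
  then have "evaluates (Suc ?s) e x y"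
    by (simp add: evaluates_def[abs_def])
  then show ?thesis
    by blast
qed

lemma component_less:
  "a < 4 * prod_encode (a, b) + numeral k" "b < 4 * prod_encode (a, b) + numeral k"
  "a < 4 * a + numeral k"
  using le_prod_encode_1[of a b] le_prod_encode_2[of b a] zero_less_numeral[of k, where 'a=nat]
  by linarith+

lemma derivable_basic:
  "derivable M s 0 x 0" "derivable M s (Suc 0) x (Suc x)"
  "derivable M s 2 x (pfst x)" "derivable M s 3 x (psnd x)"
  unfolding derivable_def by simp_all

lemma derivable_PPair:
  assumes "M a x u" "M b x v"
  shows "derivable M s (4 * prod_encode (a, b) + 4) x (prod_encode (u, v))"
  unfolding derivable_def
  by (rule disjI2, rule disjI2, rule disjI2, rule disjI2, rule disjI1,
      rule exI[of _ a], rule conjI, rule component_less, rule exI[of _ b], rule conjI,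
      rule component_less) (use assms in auto)

lemma derivable_PComp:
  assumes "M b x z" "M a z y" "z < s"
  shows "derivable M s (4 * prod_encode (a, b) + 5) x y"
  unfolding derivable_def
  by (rule disjI2, rule disjI2, rule disjI2, rule disjI2, rule disjI2, rule disjI1,
      rule exI[of _ a], rule conjI, rule component_less, rule exI[of _ b], rule conjI,
      rule component_less) (use assms in auto)

lemma derivable_PRec_0:
  assumes "M a x y"
  shows "derivable M s (4 * prod_encode (a, b) + 6) (prod_encode (x, 0)) y"
  unfolding derivable_def
  by (rule disjI2, rule disjI2, rule disjI2, rule disjI2, rule disjI2, rule disjI2, rule disjI1,
      rule exI[of _ a], rule conjI, rule component_less, rule exI[of _ b], rule conjI,
      rule component_less) (simp add: assms)

lemma derivable_PRec_Suc:
  assumes "M (4 * prod_encode (a, b) + 6) (prod_encode (x, k)) v"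
    "M b (prod_encode (x, prod_encode (k, v))) y" "v < s"
  shows "derivable M s (4 * prod_encode (a, b) + 6) (prod_encode (x, Suc k)) y"
  unfolding derivable_def
  by (rule disjI2, rule disjI2, rule disjI2, rule disjI2, rule disjI2, rule disjI2, rule disjI1,
      rule exI[of _ a], rule conjI, rule component_less, rule exI[of _ b], rule conjI,
      rule component_less) (use assms in auto)

lemma derivable_PMu:
  assumes "M a (prod_encode (x, y)) 0" "\<And>m. m < y \<Longrightarrow> \<exists>v<s. M a (prod_encode (x, m)) (Suc v)"
  shows "derivable M s (4 * a + 7) x y"
  unfolding derivable_def
  by (rule disjI2, rule disjI2, rule disjI2, rule disjI2, rule disjI2, rule disjI2, rule disjI2,
      rule exI[of _ a], rule conjI, rule component_less) (use assms in auto)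

text \<open>Induction on the program. Each premise of the last evaluation rule is enumerated and
  then stays; as there are finitely many, all hold together from some stage on, so the conclusion is
  derivable at all late stages.\<close>

lemma evaluates_complete: "run p x = Some y \<Longrightarrow> \<exists>s. evaluates s (nat_of_prog p) x y"
proof (induction p arbitrary: x y)
  case (PPair f g)
  then obtain a b where ab: "run f x = Some a" "run g x = Some b" "y = prod_encode (a, b)"
    by (auto split: bind_splits)
  then obtain s t where "evaluates s (nat_of_prog f) x a" "evaluates t (nat_of_prog g) x b"
    using PPair.IH by blast
  then have "\<forall>\<^sub>F s in sequentially. evaluates s (nat_of_prog f) x a \<and> evaluates s (nat_of_prog g) x b"
    by (intro eventually_conj evaluates_eventually)
  then show ?case
    unfolding ab nat_of_prog.simps
      by - (rule derivable_imp_evaluates, erule eventually_mono, elim conjE, rule derivable_PPair)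
next
  case (PComp f g)
  then obtain z where z: "run g x = Some z" "run f z = Some y"
    by (auto split: bind_splits)
  then obtain s t where "evaluates s (nat_of_prog g) x z" "evaluates t (nat_of_prog f) z y"
    using PComp.IH by blast
  then have "\<forall>\<^sub>F s in sequentially. evaluates s (nat_of_prog g) x z \<and> evaluates s (nat_of_prog f) z y"
    by (intro eventually_conj evaluates_eventually)
  then show ?case
    unfolding nat_of_prog.simps
      by - (rule derivable_imp_evaluates, erule eventually_mono, elim conjE, rule derivable_PComp,
        assumption+, rule evaluates_less)
next
  case (PRec f g)
  let ?e = "nat_of_prog (PRec f g)"
  \<comment> \<open>The successor rule for recursion refers to the same program, which calls for an
    inner induction on the counter.\<close>
  have "\<exists>s. evaluates s ?e (prod_encode (a, n)) y"
    if "run (PRec f g) (prod_encode (a, n)) = Some y" for a n y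
    using that
  proof (induction n arbitrary: y)
    case 0
    then have "run f a = Some y"
      by (simp only: run_PRec)
    then obtain s where "evaluates s (nat_of_prog f) a y"
      using PRec.IH by blast
    then have "\<forall>\<^sub>F s in sequentially. evaluates s (nat_of_prog f) a y"
      by (rule evaluates_eventually)
    then show ?case
      unfolding nat_of_prog.simps
        by - (rule derivable_imp_evaluates, erule eventually_mono, rule derivable_PRec_0)
  next
    case (Suc n)
    then obtain v where v: "run (PRec f g) (prod_encode (a, n)) = Some v"
      "run g (prod_encode (a, prod_encode (n, v))) = Some y"
      unfolding run_PRec(2) bind_eq_Some_conv by blast
    then obtain s t where "evaluates s ?e (prod_encode (a, n)) v"
      "evaluates t (nat_of_prog g) (prod_encode (a, prod_encode (n, v))) y"
      using PRec.IH Suc.IH by blast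
    then have "\<forall>\<^sub>F s in sequentially. evaluates s ?e (prod_encode (a, n)) v \<and>
        evaluates s (nat_of_prog g) (prod_encode (a, prod_encode (n, v))) y"
      by (intro eventually_conj evaluates_eventually)
    then show ?case
      unfolding nat_of_prog.simps
        by - (rule derivable_imp_evaluates, erule eventually_mono, elim conjE, rule derivable_PRec_Suc,
          assumption+, rule evaluates_less)
  qed
  from this[of "pfst x" "psnd x"] PRec.prems show ?case
    by simp
next
  case (PMu f)
  let ?e = "nat_of_prog f"
  have run: "run f (prod_encode (x, y)) = Some 0"
    "m < y \<Longrightarrow> \<exists>v. run f (prod_encode (x, m)) = Some (Suc v)" for m
    using PMu.prems unfolding run_PMu_eq_Some by blast+
  have "\<forall>\<^sub>F s in sequentially. \<exists>v<s. evaluates s ?e (prod_encode (x, m)) (Suc v)" if "m \<in> {..<y}" for m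
  proof -
    obtain v t where "evaluates t ?e (prod_encode (x, m)) (Suc v)"
      using run(2)[of m] \<open>m \<in> {..<y}\<close> PMu.IH by blast
    then have "\<forall>\<^sub>F s in sequentially. evaluates s ?e (prod_encode (x, m)) (Suc v)"
      by (rule evaluates_eventually)
    then show ?thesis
      by (elim eventually_mono) (use evaluates_less Suc_lessD in blast)
  qed
  then have "\<forall>\<^sub>F s in sequentially. \<forall>m\<in>{..<y}. \<exists>v<s. evaluates s ?e (prod_encode (x, m)) (Suc v)"
    by (intro eventually_ball_finite) auto
  moreover obtain t where "evaluates t ?e (prod_encode (x, y)) 0"
    using PMu.IH[OF run(1)] by blast
  then have "\<forall>\<^sub>F s in sequentially. evaluates s ?e (prod_encode (x, y)) 0"
    by (rule evaluates_eventually)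
  ultimately have "\<forall>\<^sub>F s in sequentially. evaluates s ?e (prod_encode (x, y)) 0 \<and>
      (\<forall>m<y. \<exists>v<s. evaluates s ?e (prod_encode (x, m)) (Suc v))"
    by eventually_elim auto
  then show ?case
    unfolding nat_of_prog.simps
      by - (rule derivable_imp_evaluates, erule eventually_mono, elim conjE, rule derivable_PMu, assumption, blast)
qed (simp_all add: derivable_imp_evaluates derivable_basic)

theorem evaluates_iff: "(\<exists>s. evaluates s e x y) \<longleftrightarrow> run (prog_of_nat e) x = Some y"
  using evaluates_sound evaluates_complete[of "prog_of_nat e"] by (auto simp: nat_of_prog_of_nat)

text \<open>The fact relation is indexed by a number so that it may be read off a coded table that
  varies with \<open>z\<close>.\<close>

lemma decidable_derivable:
  assumes M: "\<And>i f g h. total_computable i \<Longrightarrow> total_computable f \<Longrightarrow> total_computable g \<Longrightarrow>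
      total_computable h \<Longrightarrow> decidable (\<lambda>z. M (i z) (f z) (g z) (h z))"
    and "total_computable i" "total_computable s" "total_computable e" "total_computable x"
      "total_computable y"
  shows "decidable (\<lambda>z. derivable (M (i z)) (s z) (e z) (x z) (y z))"
proof -
  have "decidable (\<lambda>w. derivable (M (pfst w)) (pfst (psnd w)) (pfst (psnd (psnd w)))
      (pfst (psnd (psnd (psnd w)))) (psnd (psnd (psnd (psnd w)))))"
    unfolding derivable_def by (intro comp_intros M)
  from decidable_comp[OF this,
      of "\<lambda>z. prod_encode (i z, prod_encode (s z, prod_encode (e z, prod_encode (x z, y z))))"]
  show ?thesis
    using assms(2-) by (simp add: total_computable_pair)
qed

lemma decidable_evaluates [comp_intros]:
  assumes "total_computable s" "total_computable e" "total_computable x" "total_computable y"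
  shows "decidable (\<lambda>z. evaluates (s z) (e z) (x z) (y z))"
proof -
  \<comment> \<open>\<open>f s\<close> records the addition made at stage \<open>s\<close>, shifted
    by one so that 0 means none. The set \<open>facts s\<close> is thus determined by the table of
    \<open>f\<close> below \<open>s\<close>, and \<open>f\<close> is a course-of-values
    recursion.\<close>
  define f where "f s =
     (if derivable (\<lambda>e x y. prod_encode (e, prod_encode (x, y)) \<in> facts s) s
           (pfst (pfst s)) (pfst (psnd (pfst s))) (psnd (psnd (pfst s)))
      then Suc (pfst s) else 0)" for s
  have facts: "c \<in> facts s \<longleftrightarrow> (\<exists>i<s. f i = Suc c)" for c s
    by (induction s) (auto simp: f_def less_Suc_eq)
  define M where "M w e x y \<longleftrightarrow>
      (\<exists>i<pfst w. lookup (pfst w) (psnd w) i = Suc (prod_encode (e, prod_encode (x, y))))"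
    for w e x y
  have M: "decidable (\<lambda>z. M (i z) (f z) (g z) (h z))"
    if "total_computable i" "total_computable f" "total_computable g" "total_computable h"
    for i f g h
    unfolding M_def
    by (intro comp_intros that[THEN total_computable_comp] that)
  define \<Phi> where "\<Phi> s h =
     (if derivable (M (prod_encode (s, h))) s
           (pfst (pfst s)) (pfst (psnd (pfst s))) (psnd (psnd (pfst s)))
      then Suc (pfst s) else 0)" for s h
  have "f s = \<Phi> s (tabulate f s)" for s
  proof -
    have "(\<lambda>e x y. prod_encode (e, prod_encode (x, y)) \<in> facts s) =
        M (prod_encode (s, tabulate f s))"
      by (intro ext) (auto simp: M_def facts lookup_tabulate cong: conj_cong)
    then show ?thesis
      by (simp only: f_def \<Phi>_def)
  qed
  moreover have "total_computable (\<lambda>w. \<Phi> (pfst w) (psnd w))"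
    unfolding \<Phi>_def by (intro comp_intros decidable_derivable M)
  ultimately have f: "total_computable f"
    using total_computable_course_of_values by blast
  have "decidable (\<lambda>w. \<exists>i<pfst w. f i = Suc (psnd w))"
    by (intro comp_intros total_computable_comp[OF f])
  from decidable_comp[OF this, of "\<lambda>z. prod_encode (s z, prod_encode (e z, prod_encode (x z, y z)))"]
  show ?thesis
    using assms unfolding evaluates_def facts by (simp add: total_computable_pair)
qed

subsection \<open>Equivalence relations from merging labels\<close>

text \<open>Here \<open>{..<b}\<close> is the labelled segment and \<open>h\<close> a labelling: two
  columns of row \<open>e\<close> are completely labelled and carry the same labels. The bound on
  \<open>m\<close> keeps the search finite.\<close>

definition twins :: "(nat \<Rightarrow> nat \<Rightarrow> nat set) \<Rightarrow> nat \<Rightarrow> (nat \<Rightarrow> nat) \<Rightarrow> nat \<Rightarrow> bool" where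
  "twins A b h e \<longleftrightarrow>
     (\<exists>m<b. \<exists>n<m. A e n \<subseteq> {..<b} \<and> A e m \<subseteq> {..<b} \<and> h ` A e n = h ` A e m)"

text \<open>
  The second conjunct makes the construction merge at most once for each row \<open>e\<close>: equal label
  images stay equal under all later relabellings.
\<close>

definition merges :: "(nat \<Rightarrow> nat \<Rightarrow> nat set) \<Rightarrow> nat \<Rightarrow> (nat \<Rightarrow> nat) \<Rightarrow> nat \<Rightarrow> bool" where
  "merges A b c e \<longleftrightarrow> twins A b (\<lambda>x. min (c x) e) e \<and> \<not> twins A b c e"

text \<open>A stage \<open>t\<close> codes its task; the unused last component lets each task recur infinitely often.\<close>

abbreviation task_label :: "nat \<Rightarrow> nat" where "task_label t \<equiv> pfst t"
abbreviation task_row :: "nat \<Rightarrow> nat" where "task_row t \<equiv> pfst (psnd t)"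
abbreviation task_column :: "nat \<Rightarrow> nat" where "task_column t \<equiv> pfst (psnd (psnd t))"

lemma task_exists:
  "\<exists>t\<ge>N. task_label t = j \<and> task_row t = e \<and> task_column t = n"
proof -
  let ?t = "prod_encode (j, prod_encode (e, prod_encode (n, N)))"
  have "N \<le> ?t"
    by (rule order_trans[OF le_prod_encode_2 order_trans[OF le_prod_encode_2 le_prod_encode_2]])
  then show ?thesis
    by (intro exI[of _ ?t]) simp
qed

lemma not_inj_on_less:
  fixes S :: "nat set"
  assumes "\<not> inj_on f S"
  obtains n m where "n \<in> S" "m \<in> S" "n < m" "f n = f m"
proof -
  obtain n m where "n \<in> S" "m \<in> S" "n \<noteq> m" "f n = f m"
    using assms unfolding inj_on_def by blast
  then show ?thesis
    using that[of n m] that[of m n] by (cases n m rule: linorder_cases) simp_all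
qed

text \<open>The combinatorial core, free of computability: \<open>b t\<close> is the length of the
  labelled segment and \<open>c t\<close> the labelling at stage \<open>t\<close>.\<close>

locale merging_construction =
  fixes A :: "nat \<Rightarrow> nat \<Rightarrow> nat set"
    and b :: "nat \<Rightarrow> nat"
    and c :: "nat \<Rightarrow> nat \<Rightarrow> nat"
  assumes bound_less: "b t < b (Suc t)"
    and relabel: "x < b t \<Longrightarrow> c (Suc t) x =
      (if merges A (b t) (c t) (task_row t) then min (c t x) (task_row t) else c t x)"
    and new_label: "b t \<le> x \<Longrightarrow> x < b (Suc t) \<Longrightarrow> c (Suc t) x = task_label t"
    and hit: "\<not> A (task_row t) (task_column t) \<subseteq> {..<b t} \<Longrightarrow>
      \<exists>x\<in>A (task_row t) (task_column t). b t \<le> x \<and> x < b (Suc t)"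
begin

abbreviation merge_at :: "nat \<Rightarrow> bool" where
  "merge_at t \<equiv> merges A (b t) (c t) (task_row t)"

lemma bound_mono: "t \<le> t' \<Longrightarrow> b t \<le> b t'"
  by (rule lift_Suc_mono_le) (rule less_imp_le[OF bound_less])

lemma stage_le_bound: "t \<le> b t"
proof (induction t)
  case (Suc t)
  then show ?case
    using bound_less[of t] by simp
qed simp

lemma less_bound_eventually: "\<exists>t. x < b t"
  using stage_le_bound[of "Suc x"] Suc_le_lessD by blast

text \<open>The new label of an old point depends only on its old label.\<close>

lemma label_eq_persistent:
  assumes "t \<le> t'" "x < b t" "y < b t" "c t x = c t y"
  shows "c t' x = c t' y"
  using assms(1)
proof (induction rule: dec_induct)
  case (step n)
  then show ?case
    using relabel[of x n] relabel[of y n] assms bound_mono[OF step(1)] by simp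
qed (rule assms(4))

lemma label_antimono:
  assumes "t \<le> t'" "x < b t"
  shows "c t' x \<le> c t x"
  using assms(1)
proof (induction rule: dec_induct)
  case (step n)
  then show ?case
    using relabel[of x n] assms bound_mono[OF step(1)] by (auto split: if_splits)
qed simp

section \<open>The limit relation\<close>

definition E :: "nat rel" where
  "E = {(x, y). \<exists>t. x < b t \<and> y < b t \<and> c t x = c t y}"

text \<open>Equality of labels at any stage persists to every later stage, so it can be tested where
  both labels are final.\<close>

lemma E_iff:
  assumes "x < b t" "y < b t" "\<And>t'. t \<le> t' \<Longrightarrow> c t' x = j" "\<And>t'. t \<le> t' \<Longrightarrow> c t' y = k"
  shows "(x, y) \<in> E \<longleftrightarrow> j = k"
proof
  assume "(x, y) \<in> E"
  then obtain t' where t': "x < b t'" "y < b t'" "c t' x = c t' y"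
    by (auto simp: E_def)
  have "c (max t t') x = c (max t t') y"
    by (rule label_eq_persistent[OF _ t']) simp
  then show "j = k"
    using assms(3,4)[of "max t t'"] by simp
next
  assume "j = k"
  then show "(x, y) \<in> E"
    using assms unfolding E_def by auto
qed

lemma equiv_E: "equiv UNIV E"
proof (rule equivI)
  show "refl E"
    using less_bound_eventually by (auto simp: refl_on_def E_def)
  show "sym E"
    by (auto simp: sym_def E_def)
  show "trans E"
  proof (rule transI)
    fix x y z assume "(x, y) \<in> E" "(y, z) \<in> E"
    then obtain s t where s: "x < b s" "y < b s" "c s x = c s y"
      and t: "y < b t" "z < b t" "c t y = c t z"
      by (auto simp: E_def)
    let ?u = "max s t"
    have "c ?u x = c ?u y" "c ?u y = c ?u z"
      using label_eq_persistent[OF _ s, of ?u] label_eq_persistent[OF _ t, of ?u] by simp_all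
    moreover have "x < b ?u" "z < b ?u"
      using s(1) t(2) bound_mono[of s ?u] bound_mono[of t ?u] by simp_all
    ultimately show "(x, z) \<in> E"
      unfolding E_def by auto
  qed
qed simp

text \<open>Equal images under \<open>g\<close> remain equal after applying \<open>h\<close>. With
  \<open>g\<close> the current labels this gives persistence; with \<open>g\<close> the truncated
  labels it shows the effect of a merge.\<close>

lemma twins_image:
  assumes "twins A (b t) g e" "\<And>x. x < b t \<Longrightarrow> c (Suc t) x = h (g x)"
  shows "twins A (b (Suc t)) (c (Suc t)) e"
proof -
  obtain m n where mn: "m < b t" "n < m" "A e n \<subseteq> {..<b t}" "A e m \<subseteq> {..<b t}"
    "g ` A e n = g ` A e m"
    using assms(1) unfolding twins_def by blast
  have "c (Suc t) ` A e k = h ` g ` A e k" if "A e k \<subseteq> {..<b t}" for k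
    unfolding image_image using that assms(2) by (intro image_cong) auto
  then have "c (Suc t) ` A e n = c (Suc t) ` A e m"
    using mn by simp
  then show ?thesis
    using mn bound_less[of t] unfolding twins_def
    by (intro exI[of _ m] conjI exI[of _ n]) auto
qed

lemma twins_persistent:
  assumes "t \<le> t'" "twins A (b t) (c t) e"
  shows "twins A (b t') (c t') e"
  using assms(1)
proof (induction rule: dec_induct)
  case (step s)
  show ?case
    by (rule twins_image[where h = "\<lambda>v. if merge_at s then min v (task_row s) else v"])
      (use step relabel in auto)
qed (rule assms(2))

lemma merge_imp_twins:
  assumes "merge_at t"
  shows "twins A (b (Suc t)) (c (Suc t)) (task_row t)"
  by (rule twins_image[where g = "\<lambda>x. min (c t x) (task_row t)" and h = "\<lambda>v. v"])
    (use assms relabel in \<open>auto simp: merges_def\<close>)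

lemma no_second_merge:
  assumes "merge_at t" "merge_at t'" "task_row t = task_row t'"
  shows "t = t'"
proof -
  have False if "merge_at t" "merge_at t'" "task_row t = task_row t'" "t < t'" for t t'
    using twins_persistent[OF _ merge_imp_twins[OF that(1)], of t'] that
    by (simp add: merges_def)
  then show ?thesis
    using assms by (metis linorder_neqE_nat)
qed

text \<open>Each row merges at most once. Only merges in rows below \<open>j\<close> can change the
  label \<open>j\<close>.\<close>

lemma finitely_many_low_merges: "\<exists>T. \<forall>t\<ge>T. merge_at t \<longrightarrow> j \<le> task_row t"
proof -
  have "finite {t. merge_at t \<and> task_row t < j}"
  proof (rule finite_imageD)
    show "finite (task_row ` {t. merge_at t \<and> task_row t < j})"
      by (rule finite_subset[of _ "{..<j}"]) auto
    show "inj_on task_row {t. merge_at t \<and> task_row t < j}"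
      using no_second_merge by (auto simp: inj_on_def)
  qed
  then obtain T where "\<And>t. t \<in> {t. merge_at t \<and> task_row t < j} \<Longrightarrow> t < T"
    unfolding finite_nat_set_iff_bounded by blast
  then show ?thesis
    by (intro exI[of _ T]) (metis (mono_tags, lifting) mem_Collect_eq not_less)
qed

lemma permanent_label: "\<exists>x t. x < b t \<and> (\<forall>t'\<ge>t. c t' x = j)"
proof -
  obtain T where T: "\<And>t. T \<le> t \<Longrightarrow> merge_at t \<Longrightarrow> j \<le> task_row t"
    using finitely_many_low_merges by blast
  obtain t where t: "T \<le> t" "task_label t = j"
    using task_exists by blast
  \<comment> \<open>The least point labelled at stage \<open>t\<close> receives \<open>j\<close>,
    and all later truncations are at values at least \<open>j\<close>.\<close>
  have "c t' (b t) = j" if "Suc t \<le> t'" for t'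
    using that
  proof (induction rule: dec_induct)
    case base
    then show ?case
      using new_label bound_less t by simp
  next
    case (step s)
    have "b t < b s"
      using bound_mono[OF step(1)] bound_less[of t] by simp
    then show ?case
      using relabel[of "b t" s] step T[of s] t by (auto simp: min_def)
  qed
  then show ?thesis
    using bound_less by blast
qed

lemma infinite_equiv_E: "infinite_equiv E"
proof -
  obtain x t where x: "\<And>j. x j < b (t j)" "\<And>j t'. t j \<le> t' \<Longrightarrow> c t' (x j) = j"
    using permanent_label by metis
  have "inj (\<lambda>j. E `` {x j})"
  proof (rule injI)
    fix j k assume "E `` {x j} = E `` {x k}"
    then have "(x j, x k) \<in> E"
      using equiv_E eq_equiv_class_iff by fastforce
    moreover have "x j < b (max (t j) (t k))" "x k < b (max (t j) (t k))"
      using x(1)[of j] x(1)[of k] bound_mono[of "t j" "max (t j) (t k)"]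
        bound_mono[of "t k" "max (t j) (t k)"] by linarith+
    then have "(x j, x k) \<in> E \<longleftrightarrow> j = k"
      by (rule E_iff) (use x(2) in auto)
    ultimately show "j = k"
      by blast
  qed
  then have "infinite (range (\<lambda>j. E `` {x j}))"
    by (simp add: finite_image_iff)
  moreover have "range (\<lambda>j. E `` {x j}) \<subseteq> UNIV // E"
    by (auto simp: quotient_def)
  ultimately show ?thesis
    using equiv_E finite_subset unfolding infinite_equiv_def by blast
qed

text \<open>The label of any \<open>y\<close> settles because it only decreases. A later task hands
  this final label to a new element of the infinite set.\<close>

lemma closure_of_infinite:
  assumes "infinite (A e n)"
  shows "E `` A e n = UNIV"
proof -
  have "\<exists>x\<in>A e n. (x, y) \<in> E" for y
  proof -
    obtain t0 where t0: "y < b t0" "\<And>t. y < b t \<Longrightarrow> c t0 y \<le> c t y"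
      using ex_has_least_nat[of "\<lambda>t. y < b t" _ "\<lambda>t. c t y"] less_bound_eventually by metis
    have const: "c t y = c t0 y" if "t0 \<le> t" for t
      using t0 label_antimono[OF that t0(1)] bound_mono[OF that]
      by (meson antisym less_le_trans)
    obtain t where t: "t0 \<le> t" "task_label t = c t0 y" "task_row t = e" "task_column t = n"
      using task_exists by blast
    have "\<not> A e n \<subseteq> {..<b t}"
      using assms finite_subset by blast
    then obtain x where x: "x \<in> A e n" "b t \<le> x" "x < b (Suc t)"
      using hit[of t] t by auto
    \<comment> \<open>New points get the task label untruncated, and the label of \<open>y\<close>
      is unchanged even if stage \<open>t\<close> merges.\<close>
    have "c (Suc t) x = c (Suc t) y"
      using new_label[OF x(2,3)] const[of "Suc t"] t by simp
    moreover have "y < b (Suc t)"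
      using t0(1) bound_mono[of t0 "Suc t"] t(1) by simp
    ultimately have "(x, y) \<in> E"
      using x unfolding E_def by auto
    then show ?thesis
      using x by blast
  qed
  then show ?thesis
    by blast
qed

lemma twins_imp_closure_eq:
  assumes "twins A (b t) (c t) e"
  shows "\<exists>n m. n \<noteq> m \<and> E `` A e n = E `` A e m"
proof -
  obtain m n where mn: "n < m" "A e n \<subseteq> {..<b t}" "A e m \<subseteq> {..<b t}" "c t ` A e n = c t ` A e m"
    using assms unfolding twins_def by blast
  have sub: "E `` A e k \<subseteq> E `` A e l"
    if kl: "A e k \<subseteq> {..<b t}" "A e l \<subseteq> {..<b t}" "c t ` A e k = c t ` A e l" for k l
  proof
    fix y assume "y \<in> E `` A e k"
    then obtain x where x: "x \<in> A e k" "(x, y) \<in> E"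
      by blast
    then have "c t x \<in> c t ` A e l"
      using kl(3) by blast
    then obtain z where z: "z \<in> A e l" "c t z = c t x"
      by (auto simp: image_iff)
    then have "(z, x) \<in> E"
      using x(1) kl(1,2) unfolding E_def by blast
    then have "(z, y) \<in> E"
      using x(2) equiv_E by (auto elim: equivE dest: transD)
    then show "y \<in> E `` A e l"
      using z(1) by blast
  qed
  have "E `` A e n = E `` A e m"
    by (rule equalityI[OF sub[OF mn(2,3,4)] sub[OF mn(3,2) mn(4)[symmetric]]])
  then show ?thesis
    using less_imp_neq[OF mn(1)] by blast
qed

theorem row_has_equal_closures: "\<exists>n m. n \<noteq> m \<and> E `` A e n = E `` A e m"
proof (cases "\<exists>n m. n \<noteq> m \<and> infinite (A e n) \<and> infinite (A e m)")
  case True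
  then show ?thesis
    using closure_of_infinite by blast
next
  case False
  then have "\<exists>k. {n. infinite (A e n)} \<subseteq> {k}"
    by blast
  then have "finite {n. infinite (A e n)}"
    using finite_subset by blast
  then have "infinite {n. finite (A e n)}"
    using finite_Collect_not[of "\<lambda>n. infinite (A e n)"] infinite_UNIV_nat by simp
  \<comment> \<open>After truncation at \<open>e\<close> the label sets are subsets of
    \<open>{..e}\<close>, of which there are \<open>2 ^ Suc e\<close>; one more column forces a
    coincidence.\<close>
  then obtain S where S: "S \<subseteq> {n. finite (A e n)}" "finite S" "card S = Suc (2 ^ Suc e)"
    using infinite_arbitrarily_large by blast
  have "finite (S \<union> (\<Union>n\<in>S. A e n))"
    using S by auto
  \<comment> \<open>The bound covers the column indices in \<open>S\<close> as well, because
    \<open>twins\<close> requires \<open>m < b t\<close>.\<close>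
  then obtain N where N: "\<And>x. x \<in> S \<union> (\<Union>n\<in>S. A e n) \<Longrightarrow> x < N"
    unfolding finite_nat_set_iff_bounded by blast
  obtain t where t: "N \<le> t" "task_row t = e"
    using task_exists by blast
  have below: "x < b t" if "x \<in> S \<union> (\<Union>n\<in>S. A e n)" for x
    using N[OF that] t(1) stage_le_bound[of t] by simp
  let ?h = "\<lambda>x. min (c t x) e"
  have "card ((\<lambda>n. ?h ` A e n) ` S) \<le> card (Pow {..e})"
    by (intro card_mono) auto
  also have "\<dots> < card S"
    using S by (simp add: card_Pow)
  finally have "\<not> inj_on (\<lambda>n. ?h ` A e n) S"
    using pigeonhole by blast
  then obtain n m where nm: "n \<in> S" "m \<in> S" "n < m" "?h ` A e n = ?h ` A e m"
    by (rule not_inj_on_less)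
  have "A e n \<subseteq> {..<b t}" "A e m \<subseteq> {..<b t}" "m < b t"
    using below nm(1,2) by blast+
  then have "twins A (b t) ?h e"
    unfolding twins_def using nm(3,4) by (intro exI[of _ m] exI[of _ n] conjI)
  \<comment> \<open>Twins after truncation are either twins already or the reason for a merge, which
    makes twins at the next stage.\<close>
  then consider "twins A (b t) (c t) e" | "merge_at t"
    using t by (auto simp: merges_def)
  then show ?thesis
  proof cases
    case 1
    then show ?thesis
      by (rule twins_imp_closure_eq)
  next
    case 2
    from merge_imp_twins[OF this] show ?thesis
      unfolding t(2) by (rule twins_imp_closure_eq)
  qed
qed

end

subsection \<open>Computable approximation of the construction\<close>

text \<open>\<open>R s e n x\<close> is to be read as: \<open>x\<close> has entered the set in row
  \<open>e\<close> and column \<open>n\<close> by stage \<open>s\<close>.\<close>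

locale ce_array =
  fixes R :: "nat \<Rightarrow> nat \<Rightarrow> nat \<Rightarrow> nat \<Rightarrow> bool"
  assumes R_mono: "R s e n x \<Longrightarrow> s \<le> s' \<Longrightarrow> R s' e n x"
    and decidable_R: "total_computable f \<Longrightarrow> total_computable g \<Longrightarrow> total_computable h \<Longrightarrow>
      total_computable k \<Longrightarrow> decidable (\<lambda>z. R (f z) (g z) (h z) (k z))"
begin

definition A :: "nat \<Rightarrow> nat \<Rightarrow> nat set" where
  "A e n = {x. \<exists>s. R s e n x}"

definition bounded_at :: "nat \<Rightarrow> nat \<Rightarrow> nat \<Rightarrow> nat \<Rightarrow> bool" where
  "bounded_at s b e n \<longleftrightarrow> (\<forall>x<s. R s e n x \<longrightarrow> x < b)"

definition covers_at :: "nat \<Rightarrow> nat \<Rightarrow> (nat \<Rightarrow> nat) \<Rightarrow> nat \<Rightarrow> nat \<Rightarrow> nat \<Rightarrow> bool" where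
  "covers_at s b h e n m \<longleftrightarrow> (\<forall>x<b. R s e n x \<longrightarrow> (\<exists>y<b. R s e m y \<and> h x = h y))"

definition twins_at :: "nat \<Rightarrow> nat \<Rightarrow> (nat \<Rightarrow> nat) \<Rightarrow> nat \<Rightarrow> bool" where
  "twins_at s b h e \<longleftrightarrow> (\<exists>m<b. \<exists>n<m. bounded_at s b e n \<and> bounded_at s b e m \<and>
     covers_at s b h e n m \<and> covers_at s b h e m n)"

definition merges_at :: "nat \<Rightarrow> nat \<Rightarrow> (nat \<Rightarrow> nat) \<Rightarrow> nat \<Rightarrow> bool" where
  "merges_at s b c e \<longleftrightarrow> twins_at s b (\<lambda>x. min (c x) e) e \<and> \<not> twins_at s b c e"

definition first_new_at :: "nat \<Rightarrow> nat \<Rightarrow> nat \<Rightarrow> nat \<Rightarrow> nat" where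
  "first_new_at s b e n = bounded_least (\<lambda>x. b \<le> x \<and> R s e n x) s"

definition next_bound_at :: "nat \<Rightarrow> nat \<Rightarrow> nat \<Rightarrow> nat \<Rightarrow> nat" where
  "next_bound_at s b e n = Suc (if first_new_at s b e n < s then first_new_at s b e n else b)"

text \<open>The new segment ends just after the least unlabelled element, as \<open>hit\<close>
  demands; without one, a single point is added so that the segment still grows.\<close>

definition next_bound :: "nat \<Rightarrow> nat \<Rightarrow> nat \<Rightarrow> nat" where
  "next_bound b e n = Suc (if A e n \<subseteq> {..<b} then b else LEAST x. b \<le> x \<and> x \<in> A e n)"

lemma R_eventually: "\<forall>\<^sub>F s in sequentially. R s e n x \<longleftrightarrow> x \<in> A e n"
proof (cases "x \<in> A e n")
  case True
  then obtain s where "R s e n x"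
    by (auto simp: A_def)
  then show ?thesis
    using True R_mono unfolding eventually_sequentially by blast
next
  case False
  then show ?thesis
    by (simp add: A_def)
qed

lemma bounded_at_eventually:
  "\<forall>\<^sub>F s in sequentially. bounded_at s b e n \<longleftrightarrow> A e n \<subseteq> {..<b}"
proof (cases "A e n \<subseteq> {..<b}")
  case True
  then have "bounded_at s b e n" for s
    by (auto simp: bounded_at_def A_def)
  then show ?thesis
    using True by simp
next
  case False
  then obtain x where x: "x \<in> A e n" "\<not> x < b"
    by auto
  show ?thesis
    using R_eventually[of e n x] eventually_gt_at_top[of x]
    by eventually_elim (use x False in \<open>auto simp: bounded_at_def\<close>)
qed

lemma covers_at_eventually:
  "\<forall>\<^sub>F s in sequentially. covers_at s b h e n m \<longleftrightarrow>
     (\<forall>x<b. x \<in> A e n \<longrightarrow> (\<exists>y<b. y \<in> A e m \<and> h x = h y))"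
proof -
  have "\<forall>\<^sub>F s in sequentially. \<forall>x\<in>{..<b}. (R s e n x \<longleftrightarrow> x \<in> A e n) \<and> (R s e m x \<longleftrightarrow> x \<in> A e m)"
    by (intro eventually_ball_finite ballI eventually_conj R_eventually) simp
  then show ?thesis
    by eventually_elim (simp add: covers_at_def cong: conj_cong imp_cong)
qed

text \<open>Equality of label sets is split into two inclusions with quantifiers bounded by
  \<open>b\<close>, matching \<open>covers_at\<close>.\<close>

lemma twins_iff:
  "twins A b h e \<longleftrightarrow> (\<exists>m<b. \<exists>n<m. A e n \<subseteq> {..<b} \<and> A e m \<subseteq> {..<b} \<and>
     (\<forall>x<b. x \<in> A e n \<longrightarrow> (\<exists>y<b. y \<in> A e m \<and> h x = h y)) \<and>
     (\<forall>x<b. x \<in> A e m \<longrightarrow> (\<exists>y<b. y \<in> A e n \<and> h x = h y)))"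
proof -
  have "h ` X \<subseteq> h ` Y \<longleftrightarrow> (\<forall>x<b. x \<in> X \<longrightarrow> (\<exists>y<b. y \<in> Y \<and> h x = h y))"
    if "X \<subseteq> {..<b}" "Y \<subseteq> {..<b}" for X Y
    unfolding image_subset_iff image_iff using that by (simp add: subset_iff) blast
  then show ?thesis
    unfolding twins_def set_eq_subset by (simp cong: conj_cong)
qed

lemma twins_at_eventually: "\<forall>\<^sub>F s in sequentially. twins_at s b h e \<longleftrightarrow> twins A b h e"
proof -
  let ?covers = "\<lambda>n m. \<forall>x<b. x \<in> A e n \<longrightarrow> (\<exists>y<b. y \<in> A e m \<and> h x = h y)"
  have "\<forall>\<^sub>F s in sequentially. \<forall>n\<in>{..<b}. \<forall>m\<in>{..<b}.
      (bounded_at s b e n \<longleftrightarrow> A e n \<subseteq> {..<b}) \<and> (covers_at s b h e n m \<longleftrightarrow> ?covers n m)"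
    by (intro eventually_ball_finite ballI eventually_conj bounded_at_eventually
        covers_at_eventually) simp_all
  then show ?thesis
  proof eventually_elim
    case (elim s)
    then show ?case
      unfolding twins_at_def twins_iff
      by (intro ex_cong1 conj_cong refl) simp_all
  qed
qed

lemma merges_at_eventually: "\<forall>\<^sub>F s in sequentially. merges_at s b c e \<longleftrightarrow> merges A b c e"
  using twins_at_eventually[of b "\<lambda>x. min (c x) e" e] twins_at_eventually[of b c e]
  by eventually_elim (simp add: merges_at_def merges_def)

lemma first_new:
  assumes "\<not> A e n \<subseteq> {..<b}"
  shows "b \<le> (LEAST x. b \<le> x \<and> x \<in> A e n) \<and> (LEAST x. b \<le> x \<and> x \<in> A e n) \<in> A e n"
proof -
  obtain x where "x \<in> A e n" "\<not> x < b"
    using assms by auto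
  then have "b \<le> x \<and> x \<in> A e n"
    by simp
  then show ?thesis
    by (rule LeastI)
qed

text \<open>The least new element is seen at all late stages, and nothing smaller can precede it
  since \<open>R\<close> only enumerates true elements.\<close>

lemma next_bound_at_eventually:
  "\<forall>\<^sub>F s in sequentially. next_bound_at s b e n = next_bound b e n"
proof (cases "A e n \<subseteq> {..<b}")
  case True
  then have "\<not> (b \<le> x \<and> R s e n x)" for s x
    by (auto simp: A_def)
  then have "first_new_at s b e n = s" for s
    unfolding first_new_at_def by (intro bounded_least_eqI) auto
  then show ?thesis
    using True by (simp add: next_bound_at_def next_bound_def)
next
  case False
  define x where "x = (LEAST x. b \<le> x \<and> x \<in> A e n)"
  have x: "b \<le> x" "x \<in> A e n"
    using first_new[OF False] by (simp_all add: x_def)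
  show ?thesis
    using R_eventually[of e n x] eventually_gt_at_top[of x]
  proof eventually_elim
    case (elim s)
    have "\<not> (b \<le> y \<and> R s e n y)" if "y < x" for y
      using not_less_Least[OF that[unfolded x_def]] by (auto simp: A_def)
    then have "first_new_at s b e n = x"
      unfolding first_new_at_def using elim x by (intro bounded_least_eqI) auto
    then show ?case
      using elim False by (simp add: next_bound_at_def next_bound_def x_def)
  qed
qed

section \<open>Coded states and their limits\<close>

abbreviation bound :: "nat \<Rightarrow> nat" where "bound g \<equiv> pfst g"

definition label :: "nat \<Rightarrow> nat \<Rightarrow> nat" where
  "label g = lookup (bound g) (psnd g)"

text \<open>A state codes the bound and the table of labels. The merge decision and the new bound
  are arguments, so the exact and the approximate runs share this step.\<close>

definition next_state :: "bool \<Rightarrow> nat \<Rightarrow> nat \<Rightarrow> nat \<Rightarrow> nat" where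
  "next_state merge b t g = prod_encode (b, tabulate (\<lambda>x.
     if x < bound g then if merge then min (label g x) (task_row t) else label g x
     else task_label t) b)"

definition state_at :: "nat \<Rightarrow> nat \<Rightarrow> nat" where
  "state_at s t = rec_nat (prod_encode (0, 0)) (\<lambda>t g.
     next_state (merges_at s (bound g) (label g) (task_row t))
       (next_bound_at s (bound g) (task_row t) (task_column t)) t g) t"

definition state :: "nat \<Rightarrow> nat" where
  "state t = rec_nat (prod_encode (0, 0)) (\<lambda>t g.
     next_state (merges A (bound g) (label g) (task_row t))
       (next_bound (bound g) (task_row t) (task_column t)) t g) t"

text \<open>Once the state at \<open>t\<close> is correct, the next step depends on only two further
  decisions, each of which is eventually correct.\<close>

lemma state_at_eventually: "\<forall>\<^sub>F s in sequentially. state_at s t = state t"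
proof (induction t)
  case 0
  then show ?case
    by (simp add: state_at_def state_def)
next
  case (Suc t)
  from Suc merges_at_eventually[of "bound (state t)" "label (state t)" "task_row t"]
    next_bound_at_eventually[of "bound (state t)" "task_row t" "task_column t"]
  show ?case
    by eventually_elim (simp add: state_at_def state_def)
qed

lemma bound_next_state: "bound (next_state m b t g) = b"
  by (simp add: next_state_def)

lemma label_next_state:
  "x < b \<Longrightarrow> label (next_state m b t g) x =
     (if x < bound g then if m then min (label g x) (task_row t) else label g x else task_label t)"
  by (simp add: next_state_def label_def lookup_tabulate)

lemma state_Suc:
  "state (Suc t) = next_state (merges A (bound (state t)) (label (state t)) (task_row t))
     (next_bound (bound (state t)) (task_row t) (task_column t)) t (state t)"
  by (simp add: state_def)

lemma less_next_bound: "b < next_bound b e n"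
proof (cases "A e n \<subseteq> {..<b}")
  case False
  then show ?thesis
    using first_new[OF False] by (simp add: next_bound_def)
qed (simp add: next_bound_def)

sublocale merging_construction A "\<lambda>t. bound (state t)" "\<lambda>t. label (state t)"
proof
  fix t
  let ?b = "bound (state t)" and ?b' = "bound (state (Suc t))"
  have b': "?b' = next_bound ?b (task_row t) (task_column t)"
    by (simp add: state_Suc bound_next_state)
  show less: "?b < ?b'"
    unfolding b' by (rule less_next_bound)
  show "\<exists>x\<in>A (task_row t) (task_column t). ?b \<le> x \<and> x < ?b'"
    if "\<not> A (task_row t) (task_column t) \<subseteq> {..<?b}"
    using first_new[OF that] that unfolding b' next_bound_def by auto
  fix x
  show "label (state (Suc t)) x =
      (if merges A ?b (label (state t)) (task_row t) then min (label (state t) x) (task_row t)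
       else label (state t) x)" if "x < ?b"
  proof -
    have "x < next_bound ?b (task_row t) (task_column t)"
      using that less unfolding b' by linarith
    then show ?thesis
      using that by (simp add: state_Suc label_next_state)
  qed
  show "label (state (Suc t)) x = task_label t" if "?b \<le> x" "x < ?b'"
    using that unfolding b' by (simp add: state_Suc label_next_state)
qed

lemma total_computable_label [comp_intros]:
  "total_computable g \<Longrightarrow> total_computable x \<Longrightarrow> total_computable (\<lambda>z. label (g z) (x z))"
  unfolding label_def by (intro comp_intros)

lemma decidable_twins_at:
  assumes h: "\<And>i x. total_computable i \<Longrightarrow> total_computable x \<Longrightarrow> total_computable (\<lambda>z. h (i z) (x z))"
    and "total_computable s" "total_computable b" "total_computable i" "total_computable e"
  shows "decidable (\<lambda>z. twins_at (s z) (b z) (h (i z)) (e z))"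
proof -
  have "decidable (\<lambda>w. twins_at (pfst w) (pfst (psnd w)) (h (pfst (psnd (psnd w))))
      (psnd (psnd (psnd w))))"
    unfolding twins_at_def bounded_at_def covers_at_def by (intro comp_intros decidable_R h)
  from decidable_comp[OF this,
      of "\<lambda>z. prod_encode (s z, prod_encode (b z, prod_encode (i z, e z)))"]
  show ?thesis
    using assms(2-) by (simp add: total_computable_pair)
qed

lemma decidable_merges_at:
  assumes "total_computable s" "total_computable b" "total_computable g" "total_computable e"
  shows "decidable (\<lambda>z. merges_at (s z) (b z) (label (g z)) (e z))"
proof -
  \<comment> \<open>The truncated labelling is indexed by the pair of state and row.\<close>
  have "decidable (\<lambda>z. twins_at (s z) (b z)
      ((\<lambda>q x. min (label (pfst q) x) (psnd q)) (prod_encode (g z, e z))) (e z))"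
    by (rule decidable_twins_at[where h = "\<lambda>q x. min (label (pfst q) x) (psnd q)"
          and i = "\<lambda>z. prod_encode (g z, e z)"]) (assumption | intro comp_intros assms)+
  then have "decidable (\<lambda>z. twins_at (s z) (b z) (\<lambda>x. min (label (g z) x) (e z)) (e z))"
    by simp
  then show ?thesis
    unfolding merges_at_def
    by (intro decidable_conj decidable_not
        decidable_twins_at[where h = label and i = g] total_computable_label assms)
qed

lemma total_computable_next_bound_at:
  assumes "total_computable s" "total_computable b" "total_computable e" "total_computable n"
  shows "total_computable (\<lambda>z. next_bound_at (s z) (b z) (e z) (n z))"
proof -
  have "total_computable (\<lambda>w. next_bound_at (pfst w) (pfst (psnd w)) (pfst (psnd (psnd w)))
      (psnd (psnd (psnd w))))"
    unfolding next_bound_at_def first_new_at_def by (intro comp_intros decidable_R)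
  from total_computable_comp[OF this,
      of "\<lambda>z. prod_encode (s z, prod_encode (b z, prod_encode (e z, n z)))"]
  show ?thesis
    using assms by (simp add: total_computable_pair)
qed

lemma total_computable_next_state:
  assumes "decidable m" "total_computable b" "total_computable t" "total_computable g"
  shows "total_computable (\<lambda>z. next_state (m z) (b z) (t z) (g z))"
  unfolding next_state_def
  by (intro comp_intros decidable_comp[OF assms(1)] assms(2)
      total_computable_comp[OF assms(3)] total_computable_comp[OF assms(4)])

lemma total_computable_state_at:
  assumes "total_computable s" "total_computable t"
  shows "total_computable (\<lambda>z. state_at (s z) (t z))"
  unfolding state_at_def
  by (intro total_computable_rec total_computable_next_state decidable_merges_at
      total_computable_next_bound_at total_computable_comp[OF assms(1)] comp_intros assms(2))

text \<open>Because \<open>state_at v t\<close> is eventually \<open>state t\<close>, a property of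
  \<open>state t\<close> holds iff it holds of \<open>state_at v t\<close> for all
  \<open>v \<ge> N\<close>, for some \<open>N\<close>. Prefixing the stage \<open>t\<close> gives
  the form \<exists>\<forall> over a computable matrix.\<close>

lemma sigma2_E: "sigma0_rel 2 E"
proof -
  \<comment> \<open>Here \<open>z\<close> codes \<open>((x, y), (t, N))\<close> together with
    \<open>v\<close>; the first disjunct excuses all \<open>v < N\<close>.\<close>
  define C where "C = {z. let g = state_at (psnd z) (pfst (psnd (pfst z)));
        x = pfst (pfst (pfst z)); y = psnd (pfst (pfst z)) in
      psnd z < psnd (psnd (pfst z)) \<or> x < bound g \<and> y < bound g \<and> label g x = label g y}"
  have "decidable (\<lambda>z. z \<in> C)"
    unfolding C_def mem_Collect_eq Let_def by (intro comp_intros total_computable_state_at)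
  then have "computable_set C"
    by (simp add: computable_set_def decidable_def)
  moreover have "prod_encode ` E = {z. \<exists>y. \<forall>v. prod_encode (prod_encode (z, y), v) \<in> C}"
  proof -
    have E_iff_C: "(x, y) \<in> E \<longleftrightarrow> (\<exists>w. \<forall>v. prod_encode (prod_encode (prod_encode (x, y), w), v) \<in> C)"
      for x y
    proof -
      let ?P = "\<lambda>g. x < bound g \<and> y < bound g \<and> label g x = label g y"
      have lim: "?P (state t) \<longleftrightarrow> (\<forall>\<^sub>F s in sequentially. ?P (state_at s t))" for t
      proof -
        have "\<forall>\<^sub>F s in sequentially. ?P (state_at s t) \<longleftrightarrow> ?P (state t)"
          using state_at_eventually[of t] by eventually_elim simp
        from eventually_subst[OF this] show ?thesis
          by simp
      qed
      have "(x, y) \<in> E \<longleftrightarrow> (\<exists>t. \<forall>\<^sub>F s in sequentially. ?P (state_at s t))"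
        unfolding E_def using lim by simp
      also have "\<dots> \<longleftrightarrow> (\<exists>t N. \<forall>v. v < N \<or> ?P (state_at v t))"
        unfolding eventually_sequentially not_less[symmetric] disj_imp ..
      also have "\<dots> \<longleftrightarrow> (\<exists>w. \<forall>v. v < psnd w \<or> ?P (state_at v (pfst w)))"
        by (rule ex_prod_decode)
      finally show ?thesis
        by (simp add: C_def Let_def)
    qed
    show ?thesis
    proof (intro set_eqI)
      fix z
      have "z \<in> prod_encode ` E \<longleftrightarrow> prod_decode z \<in> E"
        using inj_image_mem_iff[OF inj_prod_encode, of "prod_decode z" E]
        unfolding prod_decode_inverse .
      also have "\<dots> \<longleftrightarrow> z \<in> {z. \<exists>y. \<forall>v. prod_encode (prod_encode (z, y), v) \<in> C}"
        using E_iff_C[of "pfst z" "psnd z"] by simp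
      finally show "z \<in> prod_encode ` E \<longleftrightarrow> z \<in> {z. \<exists>y. \<forall>v. prod_encode (prod_encode (z, y), v) \<in> C}" .
    qed
  qed
  ultimately show ?thesis
    unfolding sigma0_rel_def numeral_2_eq_2 sigma0.simps pi0.simps
    by (intro exI[of _ "{z. \<forall>v. prod_encode (z, v) \<in> C}"] exI[of _ C] conjI) simp_all
qed

end

theorem sigma2_not_reducible:
  "\<exists>E. infinite_equiv E \<and> sigma0_rel 2 E \<and> \<not> reducible Id (jump E)"
proof -
  \<comment> \<open>Within \<open>s\<close> stages, program \<open>e\<close> on \<open>n\<close>
    yields \<open>v\<close> and program \<open>v\<close> halts on \<open>x\<close>. The limit set is
    \<open>W v\<close>, and is empty if \<open>e\<close> diverges on \<open>n\<close>.\<close>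
  define R where "R s e n x \<longleftrightarrow> (\<exists>v<s. \<exists>y<s. evaluates s e n v \<and> evaluates s v x y)" for s e n x
  interpret ce_array R
  proof
    show "R s' e n x" if "R s e n x" "s \<le> s'" for s e n x s'
    proof -
      obtain v y where "v < s" "y < s" "evaluates s e n v" "evaluates s v x y"
        using \<open>R s e n x\<close> unfolding R_def by blast
      then show ?thesis
        unfolding R_def using \<open>s \<le> s'\<close>
        by (intro exI[of _ v] exI[of _ y] conjI evaluates_mono[OF _ \<open>s \<le> s'\<close>]) simp_all
    qed
    show "decidable (\<lambda>z. R (s z) (e z) (n z) (x z))"
      if "total_computable s" "total_computable e" "total_computable n" "total_computable x"
      for s e n x :: "nat \<Rightarrow> nat"
      unfolding R_def
      by (intro comp_intros that that[THEN total_computable_comp])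
  qed
  have A: "A e n = W v" if v: "run (prog_of_nat e) n = Some v" for e n v
  proof (intro set_eqI iffI)
    fix x assume "x \<in> A e n"
    then obtain s u y where "evaluates s e n u" "evaluates s u x y"
      unfolding A_def R_def by blast
    then have "run (prog_of_nat v) x = Some y"
      using evaluates_sound v by fastforce
    then show "x \<in> W v"
      by (simp add: W_def)
  next
    fix x assume "x \<in> W v"
    then obtain y where y: "run (prog_of_nat v) x = Some y"
      by (auto simp: W_def)
    from v y obtain s s' where "evaluates s e n v" "evaluates s' v x y"
      unfolding evaluates_iff[symmetric] by blast
    then have "evaluates (max s s') e n v" "evaluates (max s s') v x y"
      by (simp_all add: evaluates_mono[OF _ max.cobounded1] evaluates_mono[OF _ max.cobounded2])
    then show "x \<in> A e n"
      unfolding A_def R_def using evaluates_less by blast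
  qed
  have "\<not> reducible Id (jump E)"
  proof
    assume "reducible Id (jump E)"
    then obtain f where f: "total_computable f" "\<And>x y. x = y \<longleftrightarrow> E `` W (f x) = E `` W (f y)"
      unfolding reducible_def jump_def by auto
    then obtain p where "\<And>x. run p x = Some (f x)"
      unfolding total_computable_def by blast
    \<comment> \<open>A reduction would be one row of the array, and every row has two columns with
      equal closures.\<close>
    then have "A (nat_of_prog p) n = W (f n)" for n
      by (intro A) (simp add: prog_of_nat_of_prog)
    then show False
      using row_has_equal_closures[of "nat_of_prog p"] f(2) by auto
  qed
  then show ?thesis
    using infinite_equiv_E sigma2_E by blast
qed

theorem theorem1p8:
  "(\<forall>E. infinite_equiv E \<and> pi0_rel 2 E \<longrightarrow> reducible Id (jump E)) \<and>
   (\<exists>E. infinite_equiv E \<and> sigma0_rel 2 E \<and> \<not> reducible Id (jump E))"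
  using infinite_pi2_reducible sigma2_not_reducible by blast

end
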